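(* $\Phi=\Theta$.
   Context: Graphs are finite, undirected, possibly with loops and parallel edges. A graph is non-separable if it is connected, has no cut-vertex, and either has no loops or has exactly one vertex and one edge. A block is a maximal non-separable subgraph; $b(G)$ is the number of blocks of $G$ having at least one edge. For vertices $u_1,u_2$, $G/u_1u_2$ denotes the graph obtained by identifying $u_1$ and $u_2$ (edges joining them become loops); $G/e$ is the contraction of edge $e$. $\Phi$ is the set of non-separable graphs $G$ with $|V(G)|\ge 2$ such that: (a') $G-e$ is non-separable for every edge $e$; (b') $b(G/e)$ is even for every edge $e$; (c') whenever $G_1,G_2$ are subgraphs of $G$ with $|E(G_1)|\ge 2$, $|E(G_2)|\ge 2$, $V(G_1)\cap V(G_2)=\{u_1,u_2\}$ (distinct vertices), $V(G_1)\cup V(G_2)=V(G)$, $E(G_1)\cap E(G_2)=\emptyset$, $E(G_1)\cup E(G_2)=E(G)$, the integers $b(G_1/u_1u_2)$, $b(G_1)-1$, $b(G_2)$ all have the same parity. Let $Z_3$ be the graph with two vertices and three parallel edges between them. For a graph $G$ and an edge $e$ of $G$ with ends $u_1,u_2$, $G(e)$ is the graph obtained from $G-e$ by adding a new vertex $w$ and two parallel edges joining $w$ and $u_1$ and two parallel edges joining $w$ and $u_2$. $\Theta$ is the smallest set of graphs containing $Z_3$ and containing $G(e)$ for every $G\in\Theta$ and every $e\in E(G)$. *)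

theory Defs
  imports Main
begin

text \<open>A graph has a vertex set, an edge set and for each edge its set of ends
(one end for a loop, two ends otherwise).  For canonicity, non-edges have no ends.\<close>

record ('v, 'e) graph =
  verts :: "'v set"
  edges :: "'e set"
  ends  :: "'e \<Rightarrow> 'v set"

definition wf_graph :: "('v, 'e) graph \<Rightarrow> bool" where
  "wf_graph G \<longleftrightarrow> finite (verts G) \<and> finite (edges G) \<and>
     (\<forall>e\<in>edges G. ends G e \<subseteq> verts G \<and> (card (ends G e) = 1 \<or> card (ends G e) = 2)) \<and>
     (\<forall>e. e \<notin> edges G \<longrightarrow> ends G e = {})"

definition is_loop :: "('v, 'e) graph \<Rightarrow> 'e \<Rightarrow> bool" where
  "is_loop G e \<longleftrightarrow> card (ends G e) = 1"

definition subgraph :: "('v, 'e) graph \<Rightarrow> ('v, 'e) graph \<Rightarrow> bool" where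
  "subgraph H G \<longleftrightarrow> verts H \<subseteq> verts G \<and> edges H \<subseteq> edges G \<and>
     (\<forall>e\<in>edges H. ends G e \<subseteq> verts H) \<and>
     ends H = (\<lambda>e. if e \<in> edges H then ends G e else {})"

definition adj :: "('v, 'e) graph \<Rightarrow> 'v \<Rightarrow> 'v \<Rightarrow> bool" where
  "adj G x y \<longleftrightarrow> (\<exists>e\<in>edges G. x \<in> ends G e \<and> y \<in> ends G e)"

definition reach :: "('v, 'e) graph \<Rightarrow> 'v \<Rightarrow> 'v \<Rightarrow> bool" where
  "reach G x y \<longleftrightarrow> x \<in> verts G \<and> y \<in> verts G \<and> (adj G)\<^sup>*\<^sup>* x y"

definition connected_graph :: "('v, 'e) graph \<Rightarrow> bool" where
  "connected_graph G \<longleftrightarrow> verts G \<noteq> {} \<and> (\<forall>x\<in>verts G. \<forall>y\<in>verts G. reach G x y)"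

definition delete_vertex :: "('v, 'e) graph \<Rightarrow> 'v \<Rightarrow> ('v, 'e) graph" where
  "delete_vertex G v =
     (let E' = {e \<in> edges G. v \<notin> ends G e} in
      \<lparr>verts = verts G - {v}, edges = E', ends = (\<lambda>e. if e \<in> E' then ends G e else {})\<rparr>)"

definition delete_edge :: "('v, 'e) graph \<Rightarrow> 'e \<Rightarrow> ('v, 'e) graph" where
  "delete_edge G e =
     \<lparr>verts = verts G, edges = edges G - {e}, ends = (ends G)(e := {})\<rparr>"

definition cut_vertex :: "('v, 'e) graph \<Rightarrow> 'v \<Rightarrow> bool" where
  "cut_vertex G v \<longleftrightarrow> v \<in> verts G \<and>
     (\<exists>x\<in>verts G - {v}. \<exists>y\<in>verts G - {v}. reach G x y \<and> \<not> reach (delete_vertex G v) x y)"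

definition nonsep :: "('v, 'e) graph \<Rightarrow> bool" where
  "nonsep G \<longleftrightarrow> connected_graph G \<and> (\<nexists>v. cut_vertex G v) \<and>
     ((\<forall>e\<in>edges G. \<not> is_loop G e) \<or> (card (verts G) = 1 \<and> card (edges G) = 1))"

definition is_block :: "('v, 'e) graph \<Rightarrow> ('v, 'e) graph \<Rightarrow> bool" where
  "is_block H G \<longleftrightarrow> subgraph H G \<and> nonsep H \<and>
     (\<forall>H'. subgraph H' G \<and> nonsep H' \<and> subgraph H H' \<longrightarrow> H' = H)"

definition nblocks :: "('v, 'e) graph \<Rightarrow> nat" where
  "nblocks G = card {H. is_block H G \<and> edges H \<noteq> {}}"

definition identify :: "('v, 'e) graph \<Rightarrow> 'v \<Rightarrow> 'v \<Rightarrow> ('v, 'e) graph" where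
  "identify G u1 u2 =
     \<lparr>verts = (if u1 = u2 then verts G else verts G - {u2}),
      edges = edges G,
      ends = (\<lambda>e. (\<lambda>x. if x = u2 then u1 else x) ` ends G e)\<rparr>"

definition contract :: "('v, 'e) graph \<Rightarrow> 'e \<Rightarrow> ('v, 'e) graph" where
  "contract G e =
     (let u1 = (SOME x. x \<in> ends G e); u2 = (SOME y. y \<in> ends G e - {u1})
      in if card (ends G e) = 2 then identify (delete_edge G e) u1 u2 else delete_edge G e)"

definition Phi :: "('v, 'e) graph set" where
  "Phi = {G. wf_graph G \<and> nonsep G \<and> card (verts G) \<ge> 2 \<and>
     (\<forall>e\<in>edges G. nonsep (delete_edge G e)) \<and>
     (\<forall>e\<in>edges G. even (nblocks (contract G e))) \<and>
     (\<forall>G1 G2 u1 u2. subgraph G1 G \<and> subgraph G2 G \<and>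
        card (edges G1) \<ge> 2 \<and> card (edges G2) \<ge> 2 \<and> u1 \<noteq> u2 \<and>
        verts G1 \<inter> verts G2 = {u1, u2} \<and> verts G1 \<union> verts G2 = verts G \<and>
        edges G1 \<inter> edges G2 = {} \<and> edges G1 \<union> edges G2 = edges G \<longrightarrow>
        (even (int (nblocks (identify G1 u1 u2))) \<longleftrightarrow> even (int (nblocks G1) - 1)) \<and>
        (even (int (nblocks G1) - 1) \<longleftrightarrow> even (int (nblocks G2))))}"

section \<open>The class Theta (concrete representatives with vertices and edges in nat)\<close>

definition Z3 :: "(nat, nat) graph" where
  "Z3 = \<lparr>verts = {0, 1}, edges = {0, 1, 2},
         ends = (\<lambda>e. if e \<in> {0, 1, 2} then {0, 1} else {})\<rparr>"

definition expand :: "('v, 'e) graph \<Rightarrow> 'e \<Rightarrow> 'v \<Rightarrow> 'v \<Rightarrow> 'v \<Rightarrow> 'e \<Rightarrow> 'e \<Rightarrow> 'e \<Rightarrow> 'e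
    \<Rightarrow> ('v, 'e) graph" where
  "expand G e u1 u2 w f1 f2 f3 f4 =
     \<lparr>verts = insert w (verts G),
      edges = (edges G - {e}) \<union> {f1, f2, f3, f4},
      ends = ((ends G)(e := {}))(f1 := {w, u1}, f2 := {w, u1}, f3 := {w, u2}, f4 := {w, u2})\<rparr>"

inductive_set Theta :: "(nat, nat) graph set" where
  Z3: "Z3 \<in> Theta"
| expand: "\<lbrakk>G \<in> Theta; e \<in> edges G; ends G e = {u1, u2}; w \<notin> verts G;
            distinct [f1, f2, f3, f4]; {f1, f2, f3, f4} \<inter> edges G = {}\<rbrakk>
           \<Longrightarrow> expand G e u1 u2 w f1 f2 f3 f4 \<in> Theta"

definition graph_iso :: "('v, 'e) graph \<Rightarrow> ('w, 'f) graph \<Rightarrow> bool" where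
  "graph_iso G H \<longleftrightarrow> (\<exists>\<phi> \<psi>. bij_betw \<phi> (verts G) (verts H) \<and> bij_betw \<psi> (edges G) (edges H) \<and>
     (\<forall>e\<in>edges G. ends H (\<psi> e) = \<phi> ` ends G e))"

end

theory Submission
  imports Defs
begin

text \<open>Everything takes place at the level of edge sets.  A nonempty edge set is inseparable when
it cannot be split into two nonempty parts whose vertex sets share at most one vertex; blocks with
edges are exactly the maximal inseparable edge sets, and their number is additive over such splits.

For \<open>\<Theta> \<subseteq> \<Phi>\<close>, replacing an edge $uv$ that is not a bridge by two doubled edges
$uw$, $wv$ does not change the number of blocks, so the parity conditions before and after the
expansion match 2-separation by 2-separation; only the separations cutting through $w$ are new.

For \<open>\<Phi> \<subseteq> \<Theta>\<close>, take a 2-separation one of whose sides $P$ is separable and as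
small as possible.  Then $P$ is a chain of two blocks, and each of them must be a doubled edge: an odd
block count on one side of a 2-separation forces the side, with its two attachment vertices
identified, to fall apart, which splits it into two parallel pieces; a piece with at least two edges
would be a smaller separable side.  So $P$ is the result of an expansion, which can be undone.\<close>

section \<open>Inseparable edge sets\<close>

text \<open>The pairs of twin edges come from condition (b'): contracting one edge turns its twin
  into a loop, a block of its own beside the single block formed by the rest, so the count is two.
  The obstacle is a replaced edge that is a bridge: one block would become two. So
  \<open>nonbridge\<close> must be available on every side of a 2-separation and after every gluing.
  It is, because in an inseparable set each vertex-disjoint part of a side has to reach both
  attachment vertices, which leaves room for only one part. Parity is exploited through the count
  one: an inseparable set has one block, so an even count excludes inseparability, and a glued side
  that is not inseparable consists of two parallel pieces. Four edges are the threshold because an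
  edge and the two pieces parallel to it yield a separable side as soon as one piece has two edges.
  If all three are single edges, the graph is \<open>Z3\<close>.\<close>

definition vs :: "('e \<Rightarrow> 'v set) \<Rightarrow> 'e set \<Rightarrow> 'v set" where
  "vs en A = (\<Union>e\<in>A. en e)"

text \<open>The arbitrary \<open>z\<close> covers both a common cut vertex and disjoint sides.
  Singletons qualify whatever their ends, so a loop is inseparable by itself but never together with
  another edge, as in the graph notion.\<close>

definition insep :: "('e \<Rightarrow> 'v set) \<Rightarrow> 'e set \<Rightarrow> bool" where
  "insep en E \<longleftrightarrow> E \<noteq> {} \<and>
     (\<forall>A B z. A \<union> B = E \<and> A \<inter> B = {} \<and> A \<noteq> {} \<and> B \<noteq> {} \<longrightarrow> \<not> vs en A \<inter> vs en B \<subseteq> {z})"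

definition parts :: "('e \<Rightarrow> 'v set) \<Rightarrow> 'e set \<Rightarrow> 'e set set" where
  "parts en E = {S. S \<subseteq> E \<and> insep en S \<and> (\<forall>T. T \<subseteq> E \<and> insep en T \<and> S \<subseteq> T \<longrightarrow> T = S)}"

definition nb :: "('e \<Rightarrow> 'v set) \<Rightarrow> 'e set \<Rightarrow> nat" where
  "nb en E = card (parts en E)"

text \<open>\<open>glue u v\<close> names the identified vertex \<open>u\<close>; by \<open>nb_glue_commute\<close> below this choice is
immaterial for block counts.\<close>

definition merge :: "'v \<Rightarrow> 'v \<Rightarrow> 'v \<Rightarrow> 'v" where
  "merge u v x = (if x = v then u else x)"

definition glue :: "'v \<Rightarrow> 'v \<Rightarrow> ('e \<Rightarrow> 'v set) \<Rightarrow> 'e \<Rightarrow> 'v set" where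
  "glue u v en e = merge u v ` en e"

lemma vs_simps [simp]:
  "vs en {} = {}" "vs en (insert e A) = en e \<union> vs en A" "vs en (A \<union> B) = vs en A \<union> vs en B"
  by (auto simp: vs_def)

lemma vs_mono: "A \<subseteq> B \<Longrightarrow> vs en A \<subseteq> vs en B"
  by (auto simp: vs_def)

lemma vs_cong: "(\<And>e. e \<in> A \<Longrightarrow> en e = en' e) \<Longrightarrow> vs en A = vs en' A"
  by (auto simp: vs_def)

lemma ends_subset_vs: "e \<in> A \<Longrightarrow> en e \<subseteq> vs en A"
  by (auto simp: vs_def)

lemma vs_glue: "vs (glue u v en) A = merge u v ` vs en A"
  by (auto simp: vs_def glue_def)

lemma insepI:
  assumes "E \<noteq> {}"
    and "\<And>A B z. \<lbrakk>A \<union> B = E; A \<inter> B = {}; A \<noteq> {}; B \<noteq> {}; vs en A \<inter> vs en B \<subseteq> {z}\<rbrakk> \<Longrightarrow> False"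
  shows "insep en E"
  using assms unfolding insep_def by blast

lemma insepD:
  assumes "insep en E" "A \<union> B = E" "A \<inter> B = {}" "A \<noteq> {}" "B \<noteq> {}"
  shows "\<not> vs en A \<inter> vs en B \<subseteq> {z}"
  using assms unfolding insep_def by blast

lemma insepE:
  assumes "E \<noteq> {}" "\<not> insep en E"
  obtains A B z where "A \<union> B = E" "A \<inter> B = {}" "A \<noteq> {}" "B \<noteq> {}" "vs en A \<inter> vs en B \<subseteq> {z}"
  using assms unfolding insep_def by blast

lemma insep_nonempty: "insep en E \<Longrightarrow> E \<noteq> {}"
  by (simp add: insep_def)

lemma insep_cong:
  assumes "\<And>e. e \<in> E \<Longrightarrow> en e = en' e"
  shows "insep en E = insep en' E"
proof -
  have "vs en A = vs en' A" if "A \<subseteq> E" for A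
    using assms that by (intro vs_cong) auto
  then show ?thesis
    unfolding insep_def by (metis Un_upper1 Un_upper2)
qed

lemma insep_singleton: "insep en {e}"
  by (rule insepI) (auto simp: Un_singleton_iff)

lemma insep_multi_edge:
  assumes "E \<noteq> {}" "x \<noteq> y" and en: "\<And>e. e \<in> E \<Longrightarrow> en e = {x, y}"
  shows "insep en E"
proof (rule insepI[OF assms(1)])
  fix A B z
  assume AB: "A \<union> B = E" "A \<inter> B = {}" "A \<noteq> {}" "B \<noteq> {}" and z: "vs en A \<inter> vs en B \<subseteq> {z}"
  have "A \<subseteq> E" "B \<subseteq> E" unfolding AB(1)[symmetric] by auto
  then have "vs en A = vs (\<lambda>_. {x, y}) A" "vs en B = vs (\<lambda>_. {x, y}) B"
    using en by (auto intro!: vs_cong)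
  then have "vs en A = {x, y}" "vs en B = {x, y}" using AB(3,4) by (simp_all add: vs_def)
  then show False using z assms(2) by auto
qed

lemma nb_cong:
  assumes "\<And>e. e \<in> E \<Longrightarrow> en e = en' e"
  shows "nb en E = nb en' E"
proof -
  have *: "A \<subseteq> E \<and> insep en A \<longleftrightarrow> A \<subseteq> E \<and> insep en' A" for A
    using assms insep_cong[of A en en'] by auto
  have "parts en E = parts en' E"
    unfolding parts_def using * by (intro Collect_cong) metis
  then show ?thesis by (simp add: nb_def)
qed

section \<open>Additivity of the block count over splits at one vertex\<close>

lemma insep_cases:
  assumes "insep en S" "S \<subseteq> A \<union> B" "vs en A \<inter> vs en B \<subseteq> {z}" "A \<inter> B = {}"
  shows "S \<subseteq> A \<or> S \<subseteq> B"
proof (rule ccontr)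
  assume *: "\<not> ?thesis"
  have "\<not> vs en (S \<inter> A) \<inter> vs en (S \<inter> B) \<subseteq> {z}"
    using assms * by (intro insepD[of en S]) auto
  moreover have "vs en (S \<inter> A) \<subseteq> vs en A" "vs en (S \<inter> B) \<subseteq> vs en B"
    by (auto intro!: vs_mono)
  ultimately show False using assms(3) by blast
qed

lemma partsI:
  assumes "S \<subseteq> E" "insep en S" "\<And>T. \<lbrakk>T \<subseteq> E; insep en T; S \<subseteq> T\<rbrakk> \<Longrightarrow> T = S"
  shows "S \<in> parts en E"
  using assms by (simp add: parts_def)

lemma partsD:
  assumes "S \<in> parts en E"
  shows "S \<subseteq> E" "insep en S" "S \<noteq> {}" "\<And>T. \<lbrakk>T \<subseteq> E; insep en T; S \<subseteq> T\<rbrakk> \<Longrightarrow> T = S"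
  using assms insep_nonempty[of en S] by (auto simp: parts_def)

lemma parts_Un_subset:
  assumes "vs en A \<inter> vs en B \<subseteq> {z}" "A \<inter> B = {}" "S \<in> parts en A"
  shows "S \<in> parts en (A \<union> B)"
proof (rule partsI)
  note S = partsD[OF assms(3)]
  show "S \<subseteq> A \<union> B" "insep en S" using S by auto
  fix T assume T: "T \<subseteq> A \<union> B" "insep en T" "S \<subseteq> T"
  have "\<not> T \<subseteq> B" using S(1,3) T(3) assms(2) by auto
  then have "T \<subseteq> A" using insep_cases[OF T(2,1) assms(1,2)] by simp
  then show "T = S" using S(4) T by simp
qed

text \<open>An inseparable subset of the union lies within one of the two sides, so being maximal in
  the union is the same as being maximal in that side.\<close>

lemma parts_Un:
  assumes "vs en A \<inter> vs en B \<subseteq> {z}" "A \<inter> B = {}"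
  shows "parts en (A \<union> B) = parts en A \<union> parts en B"
proof
  show "parts en A \<union> parts en B \<subseteq> parts en (A \<union> B)"
    using parts_Un_subset[OF assms] parts_Un_subset[of en B A z] assms
    by (auto simp: Un_commute Int_commute)
  show "parts en (A \<union> B) \<subseteq> parts en A \<union> parts en B"
  proof
    fix S assume S: "S \<in> parts en (A \<union> B)"
    have "S \<in> parts en A" if "S \<subseteq> A"
      by (rule partsI) (use partsD[OF S] that in \<open>simp_all add: le_supI1 le_supI2\<close>)
    moreover have "S \<in> parts en B" if "S \<subseteq> B"
      by (rule partsI) (use partsD[OF S] that in \<open>simp_all add: le_supI1 le_supI2\<close>)
    moreover have "S \<subseteq> A \<or> S \<subseteq> B"
      using insep_cases[OF partsD(2,1)[OF S] assms] .
    ultimately show "S \<in> parts en A \<union> parts en B" by blast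
  qed
qed

lemma finite_parts: "finite E \<Longrightarrow> finite (parts en E)"
  unfolding parts_def by (rule finite_subset[of _ "Pow E"]) auto

lemma nb_Un:
  assumes "finite A" "finite B" "vs en A \<inter> vs en B \<subseteq> {z}" "A \<inter> B = {}"
  shows "nb en (A \<union> B) = nb en A + nb en B"
proof -
  have "S \<notin> parts en B" if "S \<in> parts en A" for S
    using partsD(1,3)[OF that] partsD(1)[of S en B] assms(4) by auto
  then have "parts en A \<inter> parts en B = {}" by auto
  then show ?thesis
    using assms by (simp add: nb_def parts_Un card_Un_disjoint finite_parts)
qed

lemma nb_insep: assumes "insep en E" shows "nb en E = 1"
proof -
  have "parts en E = {E}" using assms by (auto simp: parts_def)
  then show ?thesis by (simp add: nb_def)
qed

text \<open>Removing \<open>f\<close> from its side turns a split of the larger set into a split of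
  \<open>S\<close>, unless that side is \<open>{f}\<close>; in that case both ends of
  \<open>f\<close> are shared with \<open>S\<close>.\<close>

lemma insep_insert:
  assumes S: "insep en S" and f: "f \<notin> S" and "en f = {p, q}" "p \<noteq> q" "{p, q} \<subseteq> vs en S"
  shows "insep en (insert f S)"
proof (rule insepI)
  fix A B z assume AB: "A \<union> B = insert f S" "A \<inter> B = {}" "A \<noteq> {}" "B \<noteq> {}"
    and z: "vs en A \<inter> vs en B \<subseteq> {z}"
  have "False" if AB: "A \<union> B = insert f S" "A \<inter> B = {}" "A \<noteq> {}" "B \<noteq> {}"
    and z: "vs en A \<inter> vs en B \<subseteq> {z}" and fA: "f \<in> A" for A B
  proof (cases "A = {f}")
    case True
    have "B = insert f S - {f}" using AB True by auto
    then have "B = S" using f by simp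
    then show False using z True assms by auto
  next
    case False
    have "\<not> vs en (A - {f}) \<inter> vs en B \<subseteq> {z}"
      using AB False fA f by (intro insepD[OF S]) blast+
    then show False using z vs_mono[of "A - {f}" A en] by blast
  qed
  from this[OF AB z] this[of B A] show False using AB z by blast
qed auto

section \<open>Parallel and series splittings\<close>

text \<open>If one side of a split of \<open>Q1 \<union> Q2\<close> contains both \<open>x\<close>
  and \<open>y\<close>, then \<open>P\<close> can join that side and the whole set splits. Otherwise
  the split separates \<open>x\<close> from \<open>y\<close> at a third vertex, which lies in at
  most one of \<open>Q1\<close> and \<open>Q2\<close>; in the other piece some edges are then
  attached to everything else at a single vertex.\<close>

lemma insep_parallel:
  assumes E: "insep en (P \<union> Q1 \<union> Q2)"
    and ne: "P \<noteq> {}" "Q1 \<noteq> {}" "Q2 \<noteq> {}"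
    and dj: "P \<inter> Q1 = {}" "P \<inter> Q2 = {}" "Q1 \<inter> Q2 = {}"
    and P: "vs en P \<inter> vs en (Q1 \<union> Q2) \<subseteq> {x, y}"
    and Q: "vs en Q1 \<inter> vs en Q2 = {x, y}"
  shows "insep en (Q1 \<union> Q2)"
proof (rule insepI)
  show "Q1 \<union> Q2 \<noteq> {}" using ne by simp
  fix X Y z
  assume XY: "X \<union> Y = Q1 \<union> Q2" "X \<inter> Y = {}" "X \<noteq> {}" "Y \<noteq> {}" and z: "vs en X \<inter> vs en Y \<subseteq> {z}"
  have PXY: "vs en P \<inter> (vs en X \<union> vs en Y) \<subseteq> {x, y}"
    using P XY(1) vs_simps(3)[of en X Y] by simp
  have notboth: False
    if XY: "X \<union> Y = Q1 \<union> Q2" "X \<inter> Y = {}" "X \<noteq> {}" "Y \<noteq> {}" "vs en X \<inter> vs en Y \<subseteq> {z}"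
      and PXY: "vs en P \<inter> (vs en X \<union> vs en Y) \<subseteq> {x, y}" and "{x, y} \<subseteq> vs en X" for X Y
  proof -
    have "\<not> vs en Y \<inter> vs en (X \<union> P) \<subseteq> {z}"
      using XY dj ne by (intro insepD[OF E]) auto
    then show False using that by auto
  qed
  have sep: False
    if XY: "X \<union> Y = Q1 \<union> Q2" "X \<inter> Y = {}" "X \<noteq> {}" "Y \<noteq> {}" "vs en X \<inter> vs en Y \<subseteq> {z}"
      and PXY: "vs en P \<inter> (vs en X \<union> vs en Y) \<subseteq> {x, y}"
      and pq: "{p, q} = {x, y}" "p \<in> vs en X" "p \<notin> vs en Y" "q \<in> vs en Y" "q \<notin> vs en X" for X Y p q
  proof -
    have "\<not> vs en X \<inter> vs en (Y \<union> P) \<subseteq> {p}"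
      using XY dj ne by (intro insepD[OF E]) auto
    then obtain t where t: "t \<in> vs en X" "t \<in> vs en Y" "t \<noteq> p"
      using PXY pq by auto
    then have tz: "t = z" "t \<notin> {x, y}" using XY pq by auto
    \<comment> \<open>\<open>Qi\<close> is the piece that avoids \<open>t\<close>: its edges in
      \<open>X\<close> would meet all remaining edges only in \<open>p\<close>.\<close>
    have *: False if Qi: "Qi \<union> Qj = Q1 \<union> Q2" "Qi \<inter> Qj = {}" "Qj \<noteq> {}" "P \<inter> Qi = {}" "P \<inter> Qj = {}"
      "vs en Qi \<inter> vs en Qj = {p, q}" "t \<notin> vs en Qi" for Qi Qj
    proof -
      have "p \<in> vs en Qi" using Qi by auto
      then obtain e where e: "e \<in> Qi" "p \<in> en e" by (auto simp: vs_def)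
      then have "e \<notin> Y" using pq ends_subset_vs[of e Y en] by auto
      then have eX: "X \<inter> Qi \<noteq> {}" using e XY Qi by auto
      have "\<not> vs en (X \<inter> Qi) \<inter> vs en ((Y \<inter> Qi) \<union> Qj \<union> P) \<subseteq> {p}"
      proof (rule insepD[OF E])
        show "X \<inter> Qi \<union> (Y \<inter> Qi \<union> Qj \<union> P) = P \<union> Q1 \<union> Q2" using XY Qi by auto
        show "X \<inter> Qi \<inter> (Y \<inter> Qi \<union> Qj \<union> P) = {}" using XY Qi by auto
      qed (use eX ne in auto)
      then obtain s where s: "s \<in> vs en (X \<inter> Qi)" "s \<in> vs en (Y \<inter> Qi) \<union> vs en Qj \<union> vs en P" "s \<noteq> p"
        by auto
      have m: "vs en (X \<inter> Qi) \<subseteq> vs en X" "vs en (X \<inter> Qi) \<subseteq> vs en Qi" "vs en (Y \<inter> Qi) \<subseteq> vs en Y"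
        by (auto intro!: vs_mono)
      then have "s \<in> vs en X" "s \<in> vs en Qi" using s by auto
      then have sn: "s \<noteq> t" "s \<noteq> q" "s \<notin> {x, y}" using Qi(7) pq s(3) by auto
      have "s \<notin> vs en Y" using \<open>s \<in> vs en X\<close> XY(5) tz sn by auto
      moreover have "s \<notin> vs en Qj" using \<open>s \<in> vs en Qi\<close> Qi(6) pq(1) sn by auto
      moreover have "s \<notin> vs en P" using \<open>s \<in> vs en X\<close> PXY sn by auto
      ultimately show False using s(2) m(3) by auto
    qed
    have "t \<notin> vs en Q1 \<or> t \<notin> vs en Q2" using Q tz by auto
    then show False
      using *[of Q1 Q2] *[of Q2 Q1] dj ne Q pq(1) by (auto simp: Un_commute Int_commute)
  qed
  have "{x, y} \<subseteq> vs en X \<union> vs en Y"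
    using Q XY(1) vs_simps(3)[of en X Y] vs_simps(3)[of en Q1 Q2] by auto
  then have "{x, y} \<subseteq> vs en X \<or> {x, y} \<subseteq> vs en Y
     \<or> (x \<in> vs en X \<and> x \<notin> vs en Y \<and> y \<in> vs en Y \<and> y \<notin> vs en X)
     \<or> (y \<in> vs en X \<and> y \<notin> vs en Y \<and> x \<in> vs en Y \<and> x \<notin> vs en X)" by auto
  then show False
    using notboth[OF XY z PXY] notboth[of Y X] sep[OF XY z PXY, of x y] sep[OF XY z PXY, of y x]
      XY z PXY by (auto simp: Un_commute Int_commute insert_commute)
qed

text \<open>A split of the glued set in which some side misses \<open>x\<close> or \<open>y\<close>
  would give a split of \<open>Q \<union> R\<close> before gluing, with \<open>R\<close> added to a
  suitable side. Once both vertices lie on both sides, the glued vertex is the only shared one, so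
  originally the sides meet exactly in \<open>{x, y}\<close>.\<close>

lemma insep_glue_split:
  assumes E: "insep en (Q \<union> R)" and ne: "Q \<noteq> {}" "R \<noteq> {}" "Q \<inter> R = {}"
    and R: "vs en Q \<inter> vs en R \<subseteq> {x, y}" and xy: "x \<noteq> y"
    and n: "\<not> insep (glue x y en) Q"
  obtains Q1 Q2 where "Q = Q1 \<union> Q2" "Q1 \<inter> Q2 = {}" "Q1 \<noteq> {}" "Q2 \<noteq> {}"
    "vs en Q1 \<inter> vs en Q2 = {x, y}"
proof -
  obtain A B z where AB: "A \<union> B = Q" "A \<inter> B = {}" "A \<noteq> {}" "B \<noteq> {}"
    and z: "vs (glue x y en) A \<inter> vs (glue x y en) B \<subseteq> {z}"
    using insepE[OF ne(1) n] .
  have claim: "{x, y} \<subseteq> vs en A" if AB: "A \<union> B = Q" "A \<inter> B = {}" "A \<noteq> {}" "B \<noteq> {}"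
    and z: "vs (glue x y en) A \<inter> vs (glue x y en) B \<subseteq> {z}" for A B
  proof -
    have I: "merge x y s = z" if "s \<in> vs en A" "s \<in> vs en B" for s
      using z that by (auto simp: vs_glue)
    have I': "s = z" if "s \<in> vs en A" "s \<in> vs en B" "s \<notin> {x, y}" for s
      using I[OF that(1,2)] that by (auto simp: merge_def)
    \<comment> \<open>As soon as each side has an end in \<open>{x, y}\<close>, both contain the
      glued vertex, which must then be the single shared one.\<close>
    have II: "z = x" if "s \<in> vs en A" "t \<in> vs en B" "s \<in> {x, y}" "t \<in> {x, y}" for s t
    proof -
      have "merge x y s = x" "merge x y t = x" using that by (auto simp: merge_def)
      then have "x \<in> vs (glue x y en) A" "x \<in> vs (glue x y en) B"
        using that unfolding vs_glue by (metis imageI)+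
      then show ?thesis using z by auto
    qed
    have VQ: "vs en A \<union> vs en B = vs en Q" using AB vs_simps(3)[of en A B] by simp
    have nA: "\<not> vs en A \<inter> vs en (B \<union> R) \<subseteq> {w}" for w
      by (rule insepD[OF E]) (use AB ne in auto)
    have nB: "\<not> vs en B \<inter> vs en (A \<union> R) \<subseteq> {w}" for w
      by (rule insepD[OF E]) (use AB ne in auto)
    have *: False if pq: "{p, q} = {x, y}" "q \<notin> vs en A" for p q
    proof -
      obtain t where t: "t \<in> vs en A" "t \<in> vs en B \<union> vs en R" "t \<noteq> p" using nA[of p] by auto
      then have tB: "t \<in> vs en B" "t \<notin> {x, y}" using R VQ pq by auto
      then have tz: "t = z" using I' t by auto
      show False
      proof (cases "p \<in> vs en A")
        case True
        have nxy: "s \<notin> {x, y}" if "s \<in> vs en B" for s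
          using II[OF True that] pq tz tB by auto
        obtain s where s: "s \<in> vs en B" "s \<in> vs en A \<union> vs en R" "s \<noteq> z" using nB[of z] by auto
        then have "s \<in> vs en A" using nxy R VQ by auto
        then show False using I' nxy s by auto
      next
        case False
        obtain s where s: "s \<in> vs en A" "s \<in> vs en B \<union> vs en R" "s \<noteq> z" using nA[of z] by auto
        then have "s \<notin> {x, y}" using False pq by auto
        then have "s \<in> vs en B" using s R VQ by auto
        then show False using I' s \<open>s \<notin> {x, y}\<close> by auto
      qed
    qed
    show ?thesis using *[of x y] *[of y x] by auto
  qed
  have xyA: "{x, y} \<subseteq> vs en A" by (rule claim[OF AB z])
  have xyB: "{x, y} \<subseteq> vs en B" by (rule claim[of B A]) (use AB z in auto)
  have zx: "z = x"
  proof -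
    have "x \<in> vs (glue x y en) A" "x \<in> vs (glue x y en) B"
      using xyA xyB xy unfolding vs_glue by (auto simp: merge_def image_iff intro!: bexI[of _ x])
    then show ?thesis using z by auto
  qed
  have "s \<in> {x, y}" if "s \<in> vs en A" "s \<in> vs en B" for s
  proof -
    have "merge x y s \<in> {z}" using that z unfolding vs_glue by blast
    then show ?thesis using zx by (auto simp: merge_def split: if_splits)
  qed
  then have "vs en A \<inter> vs en B = {x, y}" using xyA xyB by auto
  then show thesis using that[of A B] AB by auto
qed

text \<open>An ear of length two is added to \<open>D\<close>. A split that divides \<open>D\<close>
  contradicts its inseparability; if \<open>D\<close> lies on one side, the two sides share either
  \<open>u\<close> and \<open>v\<close>, or \<open>w\<close> and one of them.\<close>

lemma insep_path2:
  assumes D: "insep en D" and fg: "f \<notin> D" "g \<notin> D" "f \<noteq> g" "en f = {w, u}" "en g = {w, v}"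
    and uv: "u \<noteq> v" "{u, v} \<subseteq> vs en D" "w \<noteq> u" "w \<noteq> v"
  shows "insep en (D \<union> {f, g})"
proof (rule insepI)
  fix X Y z
  assume XY: "X \<union> Y = D \<union> {f, g}" "X \<inter> Y = {}" "X \<noteq> {}" "Y \<noteq> {}" and z: "vs en X \<inter> vs en Y \<subseteq> {z}"
  have both: False if XY: "X \<union> Y = D \<union> {f, g}" "X \<inter> Y = {}" "X \<noteq> {}" "Y \<noteq> {}" "vs en X \<inter> vs en Y \<subseteq> {z}"
    "f \<in> X" "g \<in> X" for X Y
  proof (cases "X \<inter> D = {}")
    case True
    have "Y = (X \<union> Y) - X" using XY by auto
    also have "\<dots> = D" unfolding XY(1) using True XY(6,7) fg by auto
    finally have "Y = D" .
    moreover have "{u, v} \<subseteq> vs en X" using XY fg by (auto simp: vs_def)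
    ultimately show False using XY(5) uv by auto
  next
    case False
    have "\<not> vs en (X \<inter> D) \<inter> vs en Y \<subseteq> {z}"
      using XY False by (intro insepD[OF D]) auto
    then show False using XY vs_mono[of "X \<inter> D" X en] by auto
  qed
  have one: False if XY: "X \<union> Y = D \<union> {f, g}" "X \<inter> Y = {}" "vs en X \<inter> vs en Y \<subseteq> {z}"
    "f \<in> X" "g \<in> Y" for X Y
  proof -
    have DXY: "D \<subseteq> X \<union> Y" unfolding XY(1) by auto
    have w: "w \<in> vs en X" "w \<in> vs en Y" "u \<in> vs en X" "v \<in> vs en Y" using XY fg by (auto simp: vs_def)
    consider "X \<inter> D = {}" | "Y \<inter> D = {}" | "X \<inter> D \<noteq> {}" "Y \<inter> D \<noteq> {}" by auto
    then show False
    proof cases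
      case 1
      then have "D \<subseteq> Y" using DXY by auto
      then have "u \<in> vs en Y" using uv vs_mono[of D Y en] by auto
      then show False using w XY(3) uv(1,3,4) by auto
    next
      case 2
      then have "D \<subseteq> X" using DXY by auto
      then have "v \<in> vs en X" using uv vs_mono[of D X en] by auto
      then show False using w XY(3) uv(1,3,4) by auto
    next
      case 3
      have "\<not> vs en (X \<inter> D) \<inter> vs en (Y \<inter> D) \<subseteq> {z}"
        using XY 3 by (intro insepD[OF D]) auto
      then show False using XY vs_mono[of "X \<inter> D" X en] vs_mono[of "Y \<inter> D" Y en] by auto
    qed
  qed
  have "f \<in> X \<or> f \<in> Y" "g \<in> X \<or> g \<in> Y" using XY by auto
  then show False using both[OF XY z] both[of Y X] one[OF XY(1,2) z] one[of Y X] XY z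
    by (auto simp: Un_commute Int_commute)
qed simp

text \<open>An edge with ends $u$ and $v$ added to the edge set $D$ is not a bridge: every union of
components of $D$ that contains the component of $u$ also contains $v$.\<close>

definition nonbridge :: "('e \<Rightarrow> 'v set) \<Rightarrow> 'e set \<Rightarrow> 'v \<Rightarrow> 'v \<Rightarrow> bool" where
  "nonbridge en D u v \<longleftrightarrow>
     (\<forall>A B. A \<union> B = D \<and> vs en A \<inter> vs en B = {} \<and> u \<notin> vs en B \<longrightarrow> v \<in> vs en A)"

lemma nonbridge_glue:
  assumes "nonbridge en D u v"
  shows "nonbridge (glue x y en) D (merge x y u) (merge x y v)"
  unfolding nonbridge_def
proof (intro allI impI)
  fix A B assume "A \<union> B = D \<and> vs (glue x y en) A \<inter> vs (glue x y en) B = {}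
    \<and> merge x y u \<notin> vs (glue x y en) B"
  then have "A \<union> B = D" "vs en A \<inter> vs en B = {}" "u \<notin> vs en B"
    by (auto simp: vs_glue)
  then have "v \<in> vs en A" using assms unfolding nonbridge_def by blast
  then show "merge x y v \<in> vs (glue x y en) A" by (simp add: vs_glue)
qed

section \<open>Replacing an edge by two doubled edges\<close>

text \<open>The functions \<open>en'\<close> and \<open>en\<close> are the ends before and after an expansion.  The case
$u = v$ is allowed, because $u$ and $v$ may have been identified, and \<open>e'\<close> may coincide with
one of the new edges.\<close>

locale edge_expansion =
  fixes en en' :: "'e \<Rightarrow> 'v set" and e' f1 f2 f3 f4 :: 'e and u v w :: 'v
  assumes distinct: "distinct [f1, f2, f3, f4]"
    and en': "en' e' = {u, v}"
    and en: "en f1 = {w, u}" "en f2 = {w, u}" "en f3 = {w, v}" "en f4 = {w, v}"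
    and w: "w \<noteq> u" "w \<noteq> v"
begin

abbreviation F :: "'e set" where "F \<equiv> {f1, f2, f3, f4}"

text \<open>Describes edges untouched by the expansion, so that every statement about
  \<open>D\<close> alone carries over between \<open>en\<close> and \<open>en'\<close>.\<close>

definition fresh :: "'e set \<Rightarrow> bool" where
  "fresh D \<longleftrightarrow> finite D \<and> e' \<notin> D \<and> D \<inter> F = {} \<and> (\<forall>e\<in>D. en' e = en e) \<and> w \<notin> vs en D"

lemma fresh_mono: "fresh D \<Longrightarrow> C \<subseteq> D \<Longrightarrow> fresh C"
  unfolding fresh_def using vs_mono[of C D en] finite_subset[of C D] by auto

lemma fresh_vs: "fresh D \<Longrightarrow> vs en' D = vs en D"
  unfolding fresh_def by (intro vs_cong) auto

lemma fresh_insep: "fresh D \<Longrightarrow> insep en' D = insep en D"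
  unfolding fresh_def by (intro insep_cong) auto

lemma fresh_nb: "fresh D \<Longrightarrow> nb en' D = nb en D"
  unfolding fresh_def by (intro nb_cong) auto

lemma vs_F: "vs en F = {w, u, v}"
  using en by auto

text \<open>In a split of \<open>insert e' D\<close>, the edge \<open>e'\<close> can be replaced by
  \<open>F\<close> on its side; the only additional vertex \<open>w\<close> lies on no edge of the
  other side.\<close>

lemma insep_expand_imp:
  assumes D: "fresh D" and ins: "insep en (D \<union> F)"
  shows "insep en' (insert e' D)"
proof (rule insepI)
  fix A B z
  assume AB: "A \<union> B = insert e' D" "A \<inter> B = {}" "A \<noteq> {}" "B \<noteq> {}" and z: "vs en' A \<inter> vs en' B \<subseteq> {z}"
  have *: False if AB: "A \<union> B = insert e' D" "A \<inter> B = {}" "B \<noteq> {}" "vs en' A \<inter> vs en' B \<subseteq> {z}"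
    and e': "e' \<in> A" for A B
  proof -
    have "B = (A \<union> B) - A" using AB(2) by auto
    then have BD: "B \<subseteq> D" unfolding AB(1) using e' by auto
    have AD: "A - {e'} \<subseteq> D" using AB(1) by auto
    note fB = fresh_mono[OF D BD] and fA = fresh_mono[OF D AD]
    have "D = (insert e' D) - {e'}" using D by (auto simp: fresh_def)
    then have D': "D = (A - {e'}) \<union> B" unfolding AB(1)[symmetric] using AB(2) e' by auto
    have "\<not> vs en ((A - {e'}) \<union> F) \<inter> vs en B \<subseteq> {z}"
    proof (rule insepD[OF ins])
      show "A - {e'} \<union> F \<union> B = D \<union> F" unfolding D' by auto
      show "(A - {e'} \<union> F) \<inter> B = {}" using fB AB(2) by (auto simp: fresh_def)
    qed (use AB in auto)
    moreover have "vs en' A = vs en (A - {e'}) \<union> {u, v}"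
    proof -
      have "A = insert e' (A - {e'})" using e' by auto
      then have "vs en' A = en' e' \<union> vs en' (A - {e'})" by (metis vs_simps(2))
      then show ?thesis using fresh_vs[OF fA] en' by auto
    qed
    ultimately show False using AB(4) fresh_vs[OF fB] vs_F fB
      by (auto simp: fresh_def)
  qed
  have "e' \<in> A \<or> e' \<in> B" using AB(1) by auto
  then show False using *[of A B] *[of B A] AB z by (auto simp: Un_commute Int_commute)
qed simp

text \<open>The case of empty \<open>D\<close> has to be excluded: \<open>{e'}\<close> is
  inseparable, whereas \<open>F\<close> splits at \<open>w\<close> when \<open>u \<noteq> v\<close>.
  Twins share two vertices and stay together, so a split either keeps \<open>F\<close> on one side,
  where \<open>e'\<close> can replace it, or cuts \<open>F\<close> at \<open>w\<close>.\<close>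

lemma insep_expand:
  assumes D: "fresh D" "D \<noteq> {}" and ins: "insep en' (insert e' D)"
  shows "insep en (D \<union> F)"
proof (rule insepI)
  fix X Y z
  assume XY: "X \<union> Y = D \<union> F" "X \<inter> Y = {}" "X \<noteq> {}" "Y \<noteq> {}" and z: "vs en X \<inter> vs en Y \<subseteq> {z}"
  have e'D: "e' \<notin> D" using D by (simp add: fresh_def)
  have all: False if XY: "X \<union> Y = D \<union> F" "X \<inter> Y = {}" "Y \<noteq> {}" "vs en X \<inter> vs en Y \<subseteq> {z}"
    and F: "F \<subseteq> X" for X Y
  proof -
    have DF: "D \<inter> F = {}" using D by (simp add: fresh_def)
    have "Y = (X \<union> Y) - X" using XY(2) by auto
    then have YD: "Y \<subseteq> D" unfolding XY(1) using F by auto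
    have "X = (X \<union> Y) - Y" using XY(2) by auto
    then have XF: "X = (D - Y) \<union> F" unfolding XY(1) using YD DF by auto
    have "\<not> vs en' (insert e' (D - Y)) \<inter> vs en' Y \<subseteq> {z}"
      by (rule insepD[OF ins]) (use YD XY(3) e'D in auto)
    moreover have "vs en' Y = vs en Y" "vs en' (D - Y) = vs en (D - Y)"
      using fresh_vs fresh_mono[OF D(1)] YD by blast+
    moreover have "vs en X = vs en (D - Y) \<union> {w, u, v}" using XF vs_F vs_simps(3)[of en "D - Y" F] by metis
    ultimately show False using XY(4) en' by auto
  qed
  have par: False if XY: "X \<union> Y = D \<union> F" "vs en X \<inter> vs en Y \<subseteq> {z}"
    and f: "f \<in> X" "g \<in> Y" "en f = en g" "en f = {w, u} \<or> en f = {w, v}" for X Y f g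
  proof -
    have "en f \<subseteq> {z}" using f ends_subset_vs[of f X en] ends_subset_vs[of g Y en] XY(2) by auto
    then show False using f w by auto
  qed
  have ser: False if XY: "X \<union> Y = D \<union> F" "X \<inter> Y = {}" "vs en X \<inter> vs en Y \<subseteq> {z}"
    and f: "f1 \<in> X" "f3 \<in> Y" for X Y
  proof -
    have m: "{w, u} \<subseteq> vs en X" "{w, v} \<subseteq> vs en Y"
      using f en ends_subset_vs by metis+
    have DXY: "D = (X \<inter> D) \<union> (Y \<inter> D)" using XY(1) by auto
    have zw: "z = w" using m XY(3) by auto
    have mX: "vs en (X \<inter> D) \<subseteq> vs en X" and mY: "vs en (Y \<inter> D) \<subseteq> vs en Y" by (auto intro!: vs_mono)
    show False
    proof (cases "X \<inter> D = {}")
      case True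
      then have "D \<subseteq> Y" using DXY by auto
      have "\<not> vs en' {e'} \<inter> vs en' D \<subseteq> {v}"
        by (rule insepD[OF ins]) (use D e'D in auto)
      then have "u \<in> vs en D" using en' fresh_vs D by auto
      then have "u \<in> vs en Y" using vs_mono[OF \<open>D \<subseteq> Y\<close>, of en] by auto
      then show False using m XY(3) zw w by auto
    next
      case False
      \<comment> \<open>Since \<open>w\<close> is the only vertex shared by \<open>X\<close> and
        \<open>Y\<close>, the edges of \<open>D\<close> in \<open>X\<close> could meet
        \<open>e'\<close> and the edges of \<open>D\<close> in \<open>Y\<close> only in
        \<open>u\<close>.\<close>
      have "\<not> vs en' (X \<inter> D) \<inter> vs en' (insert e' (Y \<inter> D)) \<subseteq> {u}"
      proof (rule insepD[OF ins])
        show "X \<inter> D \<union> insert e' (Y \<inter> D) = insert e' D" using DXY by auto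
      qed (use XY(2) False e'D in auto)
      moreover have "vs en' (X \<inter> D) = vs en (X \<inter> D)" "vs en' (Y \<inter> D) = vs en (Y \<inter> D)"
        using fresh_vs fresh_mono[OF D(1)] by auto
      ultimately obtain t where t: "t \<in> vs en (X \<inter> D)" "t = v \<or> t \<in> vs en (Y \<inter> D)"
        using en' by auto
      have "t \<noteq> w" using t D vs_mono[of "X \<inter> D" D en] by (auto simp: fresh_def)
      moreover have "t \<in> vs en X" "t \<in> vs en Y" using t mX mY m by auto
      ultimately show False using XY(3) zw by auto
    qed
  qed
  have sides: "f1 \<in> X \<or> f1 \<in> Y" "f2 \<in> X \<or> f2 \<in> Y" "f3 \<in> X \<or> f3 \<in> Y" "f4 \<in> X \<or> f4 \<in> Y"
    using XY(1) by auto
  have YX: "Y \<union> X = D \<union> F" "Y \<inter> X = {}" "vs en Y \<inter> vs en X \<subseteq> {z}"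
    using XY z by (auto simp: Un_commute Int_commute)
  have s12: "f1 \<in> X \<longleftrightarrow> f2 \<in> X" "f1 \<in> Y \<longleftrightarrow> f2 \<in> Y"
    using par[OF XY(1) z, of f1 f2] par[OF XY(1) z, of f2 f1] sides(1,2) XY(2) en by auto
  have s34: "f3 \<in> X \<longleftrightarrow> f4 \<in> X" "f3 \<in> Y \<longleftrightarrow> f4 \<in> Y"
    using par[OF XY(1) z, of f3 f4] par[OF XY(1) z, of f4 f3] sides(3,4) XY(2) en by auto
  have s13: "\<not> (f1 \<in> X \<and> f3 \<in> Y)" "\<not> (f1 \<in> Y \<and> f3 \<in> X)"
    using ser[OF XY(1,2) z] ser[OF YX] by auto
  have "F \<subseteq> X \<or> F \<subseteq> Y" using sides s12 s34 s13 by auto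
  then show False using all[OF XY(1,2,4) z] all[OF YX(1,2) XY(3) YX(3)] by blast
qed simp

lemma insep_expand_iff: "fresh D \<Longrightarrow> D \<noteq> {} \<Longrightarrow> insep en (D \<union> F) \<longleftrightarrow> insep en' (insert e' D)"
  using insep_expand insep_expand_imp by blast

lemma insep_F: "u = v \<Longrightarrow> insep en F"
  using en w by (intro insep_multi_edge[of _ w u]) auto

text \<open>A bridge is one block, but its replacement consists of two; hence the second hypothesis.
  The induction peels off edges that meet the rest, including \<open>e'\<close>, in at most one
  vertex, and both counts are additive over that split.\<close>

lemma nb_expand:
  assumes "fresh D" "u = v \<or> nonbridge en D u v"
  shows "nb en (D \<union> F) = nb en' (insert e' D)"
proof -
  have "finite D" using assms by (simp add: fresh_def)
  then show ?thesis using assms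
  proof (induction D rule: finite_psubset_induct)
    case (psubset D)
    note D = psubset.prems(1)
    show ?case
    proof (cases "insep en' (insert e' D)")
      case True
      have "insep en (D \<union> F)"
      proof (cases "D = {}")
        case True
        \<comment> \<open>Without further edges \<open>nonbridge\<close> fails, so \<open>e'\<close>
          is a loop and \<open>F\<close> consists of four parallel edges.\<close>
        then have "u = v" using psubset.prems(2) by (auto simp: nonbridge_def)
        then show ?thesis using insep_F True by simp
      next
        case False
        then show ?thesis using insep_expand D True by simp
      qed
      then show ?thesis using True by (simp add: nb_insep)
    next
      case False
      have "\<exists>A B z. A \<union> B = insert e' D \<and> A \<inter> B = {} \<and> B \<noteq> {} \<and> vs en' A \<inter> vs en' B \<subseteq> {z} \<and> e' \<in> A"
      proof -
        obtain A B z where AB: "A \<union> B = insert e' D" "A \<inter> B = {}" "A \<noteq> {}" "B \<noteq> {}" "vs en' A \<inter> vs en' B \<subseteq> {z}"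
          using insepE[OF _ False] by blast
        show ?thesis
        proof (cases "e' \<in> A")
          case True
          then show ?thesis using AB by blast
        next
          case False
          then have "e' \<in> B" using AB(1) by auto
          then show ?thesis using AB by (metis Un_commute Int_commute)
        qed
      qed
      then obtain A B z where AB: "A \<union> B = insert e' D" "A \<inter> B = {}" "B \<noteq> {}"
        "vs en' A \<inter> vs en' B \<subseteq> {z}" "e' \<in> A" by blast
      define C where "C = A - {e'}"
      have A: "A = insert e' C" "e' \<notin> C" using AB(5) by (auto simp: C_def)
      have "e' \<notin> D" using D by (simp add: fresh_def)
      moreover have "e' \<notin> B" using AB by auto
      ultimately have DCB: "D = C \<union> B" "C \<inter> B = {}" using AB(1,2) A by auto
      then have sub: "C \<subseteq> D" "B \<subseteq> D" "C \<subset> D" using AB(3) by auto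
      note fC = fresh_mono[OF D sub(1)] and fB = fresh_mono[OF D sub(2)]
      have vA: "vs en' A = {u, v} \<union> vs en C" using A fresh_vs[OF fC] en' by simp
      have z: "({u, v} \<union> vs en C) \<inter> vs en B \<subseteq> {z}" using AB(4) vA fresh_vs[OF fB] by simp
      have nbC: "u = v \<or> nonbridge en C u v"
      proof (rule ccontr)
        assume "\<not> (u = v \<or> nonbridge en C u v)"
        then have uv: "u \<noteq> v" and nn: "\<not> nonbridge en C u v" by auto
        then have nD: "nonbridge en D u v" using psubset.prems(2) by simp
        obtain P Q where PQ: "P \<union> Q = C" "vs en P \<inter> vs en Q = {}" "u \<notin> vs en Q" "v \<notin> vs en P"
          using nn unfolding nonbridge_def by blast
        have vC: "vs en C = vs en P \<union> vs en Q" using PQ(1) vs_simps(3)[of en P Q] by simp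
        \<comment> \<open>\<open>B\<close> hangs on \<open>insert e' C\<close> at no vertex but
          \<open>z\<close>, so it can be added to \<open>P\<close> or to \<open>Q\<close>, depending
          on \<open>z\<close>, keeping the two parts of \<open>D\<close> disjoint; then
          \<open>nonbridge\<close> for \<open>D\<close> applies.\<close>
        show False
        proof (cases "z \<in> insert u (vs en P)")
          case True
          have "v \<in> vs en (P \<union> B)"
            by (rule nD[unfolded nonbridge_def, rule_format, of _ Q])
               (use DCB PQ True z vC in \<open>auto simp del: insert_iff\<close>)
          then have "v = z" using z PQ by auto
          then show False using True PQ uv by auto
        next
          case False
          have "v \<in> vs en P"
            by (rule nD[unfolded nonbridge_def, rule_format, of _ "Q \<union> B"])
               (use DCB PQ False z vC in auto)
          then show False using PQ by simp
        qed
      qed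
      have IH: "nb en (C \<union> F) = nb en' A"
        using psubset.IH[OF sub(3) fC nbC] A by simp
      have "nb en (D \<union> F) = nb en ((C \<union> F) \<union> B)" by (rule arg_cong[of _ _ "nb en"]) (use DCB in auto)
      also have "\<dots> = nb en (C \<union> F) + nb en B"
      proof (rule nb_Un)
        show "vs en (C \<union> F) \<inter> vs en B \<subseteq> {z}" using z fB vs_F by (auto simp: fresh_def)
        show "(C \<union> F) \<inter> B = {}" using DCB fB by (auto simp: fresh_def)
        show "finite (C \<union> F)" "finite B" using fC fB by (auto simp: fresh_def)
      qed
      also have "\<dots> = nb en' A + nb en' B" using IH fresh_nb[OF fB] by simp
      also have "\<dots> = nb en' (A \<union> B)"
      proof (rule nb_Un[symmetric])
        show "vs en' A \<inter> vs en' B \<subseteq> {z}" "A \<inter> B = {}" using AB by auto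
        show "finite A" "finite B" using A fC fB by (auto simp: fresh_def)
      qed
      also have "\<dots> = nb en' (insert e' D)" using AB(1) by simp
      finally show ?thesis .
    qed
  qed
qed

lemma glue_expansion:
  assumes "w \<noteq> x" "w \<noteq> y"
  shows "edge_expansion (glue x y en) (glue x y en') e' f1 f2 f3 f4 (merge x y u) (merge x y v) w"
  using distinct en en' w assms by unfold_locales (auto simp: glue_def merge_def)

lemma glue_fresh:
  assumes "w \<noteq> x" "w \<noteq> y" "fresh D"
  shows "edge_expansion.fresh (glue x y en) (glue x y en') e' f1 f2 f3 f4 w D"
  using assms unfolding edge_expansion.fresh_def[OF glue_expansion[OF assms(1,2)]] fresh_def
  by (auto simp: vs_glue glue_def merge_def split: if_splits)

lemma nb_glue_expand:
  assumes "w \<noteq> x" "w \<noteq> y" "fresh D" "{u, v} = {x, y} \<or> nonbridge en D u v"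
  shows "nb (glue x y en) (D \<union> F) = nb (glue x y en') (insert e' D)"
proof (rule edge_expansion.nb_expand[OF glue_expansion glue_fresh])
  show "merge x y u = merge x y v \<or> nonbridge (glue x y en) D (merge x y u) (merge x y v)"
    using assms(4)
  proof
    assume "{u, v} = {x, y}"
    then have "merge x y u = merge x y v" by (auto simp: merge_def doubleton_eq_iff)
    then show ?thesis ..
  qed (simp add: nonbridge_glue)
qed (use assms in auto)

end

section \<open>The parity conditions and undoing an expansion\<close>

lemma vs_iso:
  assumes "\<And>e. e \<in> A \<Longrightarrow> en2 (\<psi> e) = \<phi> ` en e"
  shows "vs en2 (\<psi> ` A) = \<phi> ` vs en A"
  using assms by (auto simp: vs_def)

lemma insep_iso:
  assumes psi: "inj_on \<psi> E" and phi: "inj_on \<phi> (vs en E)" and en2: "\<And>e. e \<in> E \<Longrightarrow> en2 (\<psi> e) = \<phi> ` en e"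
  shows "insep en2 (\<psi> ` E) \<longleftrightarrow> insep en E"
proof
  assume ins: "insep en2 (\<psi> ` E)"
  show "insep en E"
  proof (rule insepI)
    show "E \<noteq> {}" using insep_nonempty[OF ins] by auto
    fix A B z assume AB: "A \<union> B = E" "A \<inter> B = {}" "A \<noteq> {}" "B \<noteq> {}" "vs en A \<inter> vs en B \<subseteq> {z}"
    have "\<not> vs en2 (\<psi> ` A) \<inter> vs en2 (\<psi> ` B) \<subseteq> {\<phi> z}"
    proof (rule insepD[OF ins])
      show "\<psi> ` A \<union> \<psi> ` B = \<psi> ` E" using AB(1) by auto
      show "\<psi> ` A \<inter> \<psi> ` B = {}" using AB(1,2) psi inj_on_image_Int[of \<psi> E A B] by auto
    qed (use AB in auto)
    moreover have "vs en2 (\<psi> ` A) = \<phi> ` vs en A" "vs en2 (\<psi> ` B) = \<phi> ` vs en B"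
      using AB(1) en2 by (auto intro!: vs_iso)
    moreover have "\<phi> ` vs en A \<inter> \<phi> ` vs en B = \<phi> ` (vs en A \<inter> vs en B)"
      using inj_on_image_Int[OF phi] AB(1) by (metis vs_simps(3) Un_upper1 Un_upper2)
    ultimately show False using AB(5) by auto
  qed
next
  assume ins: "insep en E"
  show "insep en2 (\<psi> ` E)"
  proof (rule insepI)
    show "\<psi> ` E \<noteq> {}" using insep_nonempty[OF ins] by auto
    fix A B z assume AB: "A \<union> B = \<psi> ` E" "A \<inter> B = {}" "A \<noteq> {}" "B \<noteq> {}" "vs en2 A \<inter> vs en2 B \<subseteq> {z}"
    define A' B' where "A' = {e\<in>E. \<psi> e \<in> A}" and "B' = {e\<in>E. \<psi> e \<in> B}"
    have "A \<subseteq> \<psi> ` E" "B \<subseteq> \<psi> ` E" unfolding AB(1)[symmetric] by auto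
    then have A: "A = \<psi> ` A'" "B = \<psi> ` B'" by (auto simp: A'_def B'_def)
    have E: "A' \<union> B' = E"
    proof -
      have "\<psi> e \<in> A \<union> B" if "e \<in> E" for e using AB(1) that by simp
      then show ?thesis by (auto simp: A'_def B'_def)
    qed
    have "A' \<inter> B' = {}" using AB(2) by (auto simp: A'_def B'_def)
    moreover have "A' \<noteq> {}" "B' \<noteq> {}" using AB(3,4) A by auto
    ultimately have ne: "A' \<inter> B' = {}" "A' \<noteq> {}" "B' \<noteq> {}" by simp_all
    have "vs en2 A = \<phi> ` vs en A'" "vs en2 B = \<phi> ` vs en B'"
      unfolding A using E en2 by (auto intro!: vs_iso)
    then have im: "\<phi> ` (vs en A' \<inter> vs en B') \<subseteq> {z}" using AB(5) by auto
    obtain p where p: "p \<in> vs en A'" "p \<in> vs en B'" using insepD[OF ins E ne, of undefined] by auto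
    obtain q where q: "q \<in> vs en A'" "q \<in> vs en B'" "q \<noteq> p" using insepD[OF ins E ne, of p] by auto
    have "\<phi> p = \<phi> q" using im p q by auto
    moreover have "p \<in> vs en E" "q \<in> vs en E" using p q E vs_simps(3)[of en A' B'] by auto
    ultimately show False using phi q(3) by (auto dest: inj_onD)
  qed
qed

lemma nb_iso:
  assumes psi: "inj_on \<psi> E" and phi: "inj_on \<phi> (vs en E)" and en2: "\<And>e. e \<in> E \<Longrightarrow> en2 (\<psi> e) = \<phi> ` en e"
  shows "nb en2 (\<psi> ` E) = nb en E"
proof -
  have iso: "insep en2 (\<psi> ` S) \<longleftrightarrow> insep en S" if "S \<subseteq> E" for S
    using that by (intro insep_iso[where \<phi> = \<phi>] inj_on_subset[OF psi] inj_on_subset[OF phi] en2 vs_mono) auto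
  have inj: "inj_on ((`) \<psi>) (Pow E)" using psi by (simp add: inj_on_image_Pow)
  have sub: "\<psi> ` S \<subseteq> \<psi> ` T \<longleftrightarrow> S \<subseteq> T" if "S \<subseteq> E" "T \<subseteq> E" for S T
    using inj_on_image_mem_iff[OF psi _ that(2)] that(1) by blast
  have "parts en2 (\<psi> ` E) = (`) \<psi> ` parts en E"
  proof (intro set_eqI iffI)
    fix S assume S: "S \<in> parts en2 (\<psi> ` E)"
    then obtain T where T: "T \<subseteq> E" "S = \<psi> ` T" using partsD(1)[OF S] by (auto simp: subset_image_iff)
    have "T \<in> parts en E"
    proof (rule partsI)
      fix U assume U: "U \<subseteq> E" "insep en U" "T \<subseteq> U"
      have "\<psi> ` U \<subseteq> \<psi> ` E" "S \<subseteq> \<psi> ` U" unfolding T(2) using U by (auto intro!: image_mono)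
      then have "\<psi> ` U = \<psi> ` T" using partsD(4)[OF S] iso[OF U(1)] U(2) T(2) by simp
      then show "U = T" by (rule inj_onD[OF inj]) (use T(1) U(1) in auto)
    qed (use T iso partsD[OF S] in auto)
    then show "S \<in> (`) \<psi> ` parts en E" using T by auto
  next
    fix S assume "S \<in> (`) \<psi> ` parts en E"
    then obtain T where T: "T \<in> parts en E" "S = \<psi> ` T" by auto
    note T' = partsD[OF T(1)]
    show "S \<in> parts en2 (\<psi> ` E)"
    proof (rule partsI)
      fix U assume U: "U \<subseteq> \<psi> ` E" "insep en2 U" "S \<subseteq> U"
      obtain U' where U': "U' \<subseteq> E" "U = \<psi> ` U'" using U(1) by (auto simp: subset_image_iff)
      have "T \<subseteq> U'" using U(3) sub[OF T'(1) U'(1)] unfolding T(2) U'(2) by simp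
      then have "U' = T" using T'(4)[OF U'(1)] iso[OF U'(1)] U(2) U'(2) by simp
      then show "U = S" using U' T by simp
    qed (use T T' iso in auto)
  qed
  moreover have "inj_on ((`) \<psi>) (parts en E)"
    using inj by (rule inj_on_subset) (auto dest: partsD)
  ultimately show ?thesis by (simp add: nb_def card_image)
qed

text \<open>The two gluings differ by the renaming \<open>merge y x\<close>, which is injective on
  the glued vertices because \<open>y\<close> no longer occurs among them.\<close>

lemma nb_glue_commute: "nb (glue x y en) A = nb (glue y x en) A"
proof (cases "x = y")
  case False
  have "inj_on (merge y x) (vs (glue x y en) A)"
    using False by (auto simp: vs_glue inj_on_def merge_def split: if_splits)
  moreover have "glue y x en (id e) = merge y x ` glue x y en e" for e
    using False by (force simp: glue_def merge_def image_image)
  ultimately have "nb (glue y x en) (id ` A) = nb (glue x y en) A"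
    by (intro nb_iso) auto
  then show ?thesis by simp
qed simp

text \<open>Condition (c') for one ordered pair of sides. Evenness of b(G_1)-1 over the integers is
  oddness of the count, also when the count is 0.\<close>

definition parity :: "('e \<Rightarrow> 'v set) \<Rightarrow> 'e set \<Rightarrow> 'e set \<Rightarrow> 'v \<Rightarrow> 'v \<Rightarrow> bool" where
  "parity en A B x y \<longleftrightarrow>
     (even (nb (glue x y en) A) \<longleftrightarrow> odd (nb en A)) \<and> (odd (nb en A) \<longleftrightarrow> even (nb en B))"

text \<open>Membership in \<open>Phi\<close> for a graph covered by its edges. The deletion clause
  does not mention vertices because the remaining edges still cover the ends of \<open>e\<close>,
  and contraction is gluing on \<open>E - {e}\<close>. The last clause ranges over ordered pairs, so
  it yields \<open>parity\<close> in both orders.\<close>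

definition Phi_edges :: "('e \<Rightarrow> 'v set) \<Rightarrow> 'e set \<Rightarrow> bool" where
  "Phi_edges en E \<longleftrightarrow> finite E \<and> (\<forall>e\<in>E. card (en e) = 2) \<and> insep en E \<and>
     (\<forall>e\<in>E. insep en (E - {e})) \<and>
     (\<forall>e x y. e \<in> E \<and> en e = {x, y} \<longrightarrow> even (nb (glue x y en) (E - {e}))) \<and>
     (\<forall>A B x y. A \<union> B = E \<and> A \<inter> B = {} \<and> 2 \<le> card A \<and> 2 \<le> card B \<and> x \<noteq> y \<and>
        vs en A \<inter> vs en B = {x, y} \<longrightarrow> parity en A B x y)"

lemma Phi_edgesD:
  assumes "Phi_edges en E"
  shows "finite E" "\<And>e. e \<in> E \<Longrightarrow> card (en e) = 2" "insep en E"
    "\<And>e. e \<in> E \<Longrightarrow> insep en (E - {e})"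
    "\<And>e x y. e \<in> E \<Longrightarrow> en e = {x, y} \<Longrightarrow> even (nb (glue x y en) (E - {e}))"
    "\<And>A B x y. \<lbrakk>A \<union> B = E; A \<inter> B = {}; 2 \<le> card A; 2 \<le> card B; x \<noteq> y; vs en A \<inter> vs en B = {x, y}\<rbrakk>
       \<Longrightarrow> parity en A B x y"
  using assms unfolding Phi_edges_def by blast+

lemma parity_commute_ends: "parity en A B x y = parity en A B y x"
  by (simp add: parity_def nb_glue_commute[of x y])

section \<open>Non-bridges inside inseparable sets\<close>

context edge_expansion
begin

text \<open>If \<open>u\<close> and \<open>v\<close> lay in vertex-disjoint parts of
  \<open>D\<close>, then the part of \<open>u\<close> together with \<open>e'\<close> would share
  only \<open>v\<close> with the rest.\<close>

lemma insep_nonbridge: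
  assumes D: "fresh D" "D \<noteq> {}" and ins: "insep en' (insert e' D)"
  shows "nonbridge en D u v"
  unfolding nonbridge_def
proof (intro allI impI)
  fix P Q assume PQ: "P \<union> Q = D \<and> vs en P \<inter> vs en Q = {} \<and> u \<notin> vs en Q"
  \<comment> \<open>\<open>P\<close> and \<open>Q\<close> have disjoint vertex sets but may share
    edges without ends; \<open>Q - P\<close> makes the edge sets disjoint.\<close>
  then have "P \<subseteq> D" "Q - P \<subseteq> D" by auto
  then have e: "vs en' P = vs en P" "vs en' (Q - P) = vs en (Q - P)"
    using fresh_vs fresh_mono[OF D(1)] by blast+
  have m: "vs en (Q - P) \<subseteq> vs en Q" by (intro vs_mono) auto
  have e': "e' \<notin> D" using D by (simp add: fresh_def)
  show "v \<in> vs en P"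
  proof (cases "Q - P = {}")
    case True
    then have "P = D" using PQ by auto
    have "\<not> vs en' {e'} \<inter> vs en' P \<subseteq> {u}"
      by (rule insepD[OF ins]) (use D e' \<open>P = D\<close> in auto)
    then show ?thesis using e en' by auto
  next
    case False
    have "\<not> vs en' (insert e' P) \<inter> vs en' (Q - P) \<subseteq> {v}"
      by (rule insepD[OF ins]) (use PQ False e' in auto)
    then show ?thesis using e en' m PQ by auto
  qed
qed

text \<open>\<open>B\<close> together with an edge joining \<open>u\<close> and \<open>v\<close> is
  one side of a 2-separation. If \<open>B\<close> were the union of two nonempty vertex-disjoint
  parts, each would have to contain both \<open>x\<close> and \<open>y\<close> in order not to be
  cut off from the rest.\<close>

lemma sep_nonbridge:
  assumes D: "fresh (A \<union> B)" "insep en (A \<union> B)" "A \<inter> B = {}" "A \<noteq> {}" "B \<noteq> {}"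
    and uv: "{u, v} \<subseteq> vs en (A \<union> B)" and ends: "\<And>e. e \<in> B \<Longrightarrow> en e \<noteq> {}"
    and AB: "vs en A \<inter> (vs en B \<union> {u, v}) = {x, y}"
  shows "nonbridge en B u v"
  unfolding nonbridge_def
proof (intro allI impI)
  fix P Q assume *: "P \<union> Q = B \<and> vs en P \<inter> vs en Q = {} \<and> u \<notin> vs en Q"
  then have PQ: "B = P \<union> Q" "vs en P \<inter> vs en Q = {}" "u \<notin> vs en Q" by auto
  have "en e \<subseteq> vs en P \<inter> vs en Q" if "e \<in> P" "e \<in> Q" for e
    using that ends_subset_vs by (metis Int_greatest)
  then have dj: "P \<inter> Q = {}" using ends PQ by auto
  have P: "{x, y} \<subseteq> vs en P" if "P \<noteq> {}"
  proof -
    have "\<not> vs en P \<inter> vs en (A \<union> Q) \<subseteq> {z}" for z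
      by (rule insepD[OF D(2)]) (use PQ dj D that in auto)
    moreover have "vs en P \<inter> vs en (A \<union> Q) \<subseteq> vs en P \<inter> {x, y}"
      unfolding AB[symmetric] using PQ by auto
    ultimately have "\<not> vs en P \<inter> {x, y} \<subseteq> {z}" for z by blast
    then show ?thesis by blast
  qed
  have Q: "{x, y} \<subseteq> vs en Q" if "Q \<noteq> {}"
  proof -
    have "\<not> vs en Q \<inter> vs en (A \<union> P) \<subseteq> {z}" for z
      by (rule insepD[OF D(2)]) (use PQ dj D that in auto)
    moreover have "vs en Q \<inter> vs en (A \<union> P) \<subseteq> vs en Q \<inter> {x, y}"
      unfolding AB[symmetric] using PQ by auto
    ultimately have "\<not> vs en Q \<inter> {x, y} \<subseteq> {z}" for z by blast
    then show ?thesis by blast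
  qed
  show "v \<in> vs en P"
  proof (cases "Q = {}")
    case True
    then show ?thesis using P PQ D uv AB by auto
  next
    case False
    then have "P = {}" using P Q PQ by auto
    then show ?thesis using Q PQ D uv AB by auto
  qed
qed

end

text \<open>The common setting of both directions: \<open>D\<close> is the unexpanded graph without
  \<open>e'\<close>. For a graph known to satisfy the parity conditions, \<open>insep en D\<close>
  is (a') for \<open>e'\<close>; when an expansion is undone, it comes from
  \<open>Phi_edges_structure\<close>.\<close>

locale twoconn_expansion = edge_expansion +
  fixes D
  assumes D: "fresh D" "insep en D" "2 \<le> card D" "\<And>e. e \<in> D \<Longrightarrow> card (en e) = 2"
    and uv: "u \<noteq> v" "{u, v} \<subseteq> vs en D"
begin

lemma D_simps: "finite D" "e' \<notin> D" "D \<inter> F = {}" "w \<notin> vs en D"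
  "f1 \<notin> D" "f2 \<notin> D" "f3 \<notin> D" "f4 \<notin> D"
  using D(1) by (auto simp: fresh_def)

lemma D_minus: "D - {f} \<noteq> {}"
proof
  assume "D - {f} = {}"
  then have "D \<subseteq> {f}" by auto
  then have "card D \<le> 1" using card_mono[of "{f}" D] by simp
  then show False using D(3) by simp
qed

lemma insep_minus_iff:
  "insep en (D - {f} \<union> F) \<longleftrightarrow> insep en' (insert e' (D - {f}))"
  using insep_expand_iff[OF fresh_mono[OF D(1)]] D_minus by auto

text \<open>Transfers condition (b') for an old edge \<open>f\<close>. That \<open>e'\<close> is not
  a bridge of what remains is due to (a') for \<open>f\<close>.\<close>

lemma glue_minus:
  assumes "f \<in> D" "en f = {x, y}" "insep en' (insert e' (D - {f}))"
  shows "nb (glue x y en) (D - {f} \<union> F) = nb (glue x y en') (insert e' (D - {f}))"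
proof (rule nb_glue_expand)
  have "{x, y} \<subseteq> vs en D" using assms ends_subset_vs[of f D en] by simp
  then show "w \<noteq> x" "w \<noteq> y" using D_simps by auto
  show f: "fresh (D - {f})" using fresh_mono[OF D(1)] by auto
  show "{u, v} = {x, y} \<or> nonbridge en (D - {f}) u v"
    using insep_nonbridge[OF f D_minus assms(3)] by simp
qed

text \<open>No count changes: \<open>A\<close> is untouched, and \<open>nb_expand\<close> and its
  glued version apply to the side containing \<open>e'\<close>. Both orders are stated because only
  the first argument of \<open>parity\<close> is glued.\<close>

lemma parity_expand:
  assumes AB: "A \<union> B = D" "A \<inter> B = {}" "A \<noteq> {}" "B \<noteq> {}"
    and xy: "vs en' A \<inter> vs en' (insert e' B) = {x, y}"
  shows "parity en A (B \<union> F) x y = parity en' A (insert e' B) x y"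
    "parity en (B \<union> F) A x y = parity en' (insert e' B) A x y"
proof -
  have sub: "A \<subseteq> D" "B \<subseteq> D" using AB by auto
  note fA = fresh_mono[OF D(1) sub(1)] and fB = fresh_mono[OF D(1) sub(2)]
  have xy': "vs en A \<inter> (vs en B \<union> {u, v}) = {x, y}"
    using xy fresh_vs[OF fA] fresh_vs[OF fB] en' by auto
  have nbr: "nonbridge en B u v"
  proof (rule sep_nonbridge)
    show "en e \<noteq> {}" if "e \<in> B" for e using D(4)[of e] that sub by auto
  qed (use AB D uv xy' in auto)
  have "x \<in> vs en A" "y \<in> vs en A" using xy' by auto
  then have wxy: "w \<noteq> x" "w \<noteq> y" using fA by (auto simp: fresh_def)
  have "nb en (B \<union> F) = nb en' (insert e' B)"
    using nb_expand[OF fB] nbr by simp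
  moreover have "nb (glue x y en) (B \<union> F) = nb (glue x y en') (insert e' B)"
    using nb_glue_expand[OF wxy fB] nbr by simp
  moreover have "nb en A = nb en' A" using fresh_nb[OF fA] by simp
  moreover have "nb (glue x y en) A = nb (glue x y en') A"
    using fA by (intro nb_cong) (auto simp: fresh_def glue_def)
  ultimately show "parity en A (B \<union> F) x y = parity en' A (insert e' B) x y"
    "parity en (B \<union> F) A x y = parity en' (insert e' B) A x y"
    by (simp_all add: parity_def)
qed

lemma vs_expand:
  assumes "A \<subseteq> D" "B \<subseteq> D"
  shows "vs en A \<inter> vs en (B \<union> F) = vs en' A \<inter> vs en' (insert e' B)"
proof -
  have "fresh A" "fresh B" using fresh_mono[OF D(1)] assms by auto
  then show ?thesis using fresh_vs[of A] fresh_vs[of B] en' vs_F by (auto simp: fresh_def)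
qed

theorem Phi_edges_reduce:
  assumes G: "Phi_edges en (D \<union> F)"
  shows "Phi_edges en' (insert e' D)"
  unfolding Phi_edges_def
proof (intro conjI ballI allI impI; (elim conjE)?)
  note G = Phi_edgesD[OF G]
  show "finite (insert e' D)" using D_simps by simp
  show "card (en' e) = 2" if "e \<in> insert e' D" for e
    using that D en' uv by (auto simp: fresh_def)
  show "insep en' (insert e' D)" using insep_expand_imp[OF D(1)] G(3) by simp
  have a: "insep en' (insert e' (D - {e}))" if "e \<in> D" for e
  proof -
    have "D \<union> F - {e} = D - {e} \<union> F" using that D_simps by auto
    then show ?thesis using G(4)[of e] insep_minus_iff[of e] that by simp
  qed
  show "insep en' (insert e' D - {e})" if "e \<in> insert e' D" for e
  proof (cases "e = e'")
    case True
    then have "insert e' D - {e} = D" using D_simps by auto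
    then show ?thesis using fresh_insep[OF D(1)] D(2) by simp
  next
    case False
    then have "insert e' D - {e} = insert e' (D - {e})" by auto
    then show ?thesis using a that False by simp
  qed
  show "even (nb (glue x y en') (insert e' D - {e}))" if e: "e \<in> insert e' D" "en' e = {x, y}" for e x y
  proof (cases "e = e'")
    case True
    \<comment> \<open>Condition (b') for the restored edge comes from (c') for the separation into
      \<open>D\<close> and \<open>F\<close>: \<open>D\<close> has one block, so its glued count is
      even.\<close>
    have "parity en D F x y"
    proof (rule G(6))
      show "vs en D \<inter> vs en F = {x, y}" using vs_F D_simps uv True e(2) en' by auto
      show "x \<noteq> y" using True e(2) en' uv by auto
      show "2 \<le> card F" using distinct by simp
    qed (use D D_simps in auto)
    then have "even (nb (glue x y en) D)" using nb_insep[OF D(2)] by (simp add: parity_def)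
    moreover have "nb (glue x y en) D = nb (glue x y en') D"
      using D(1) by (intro nb_cong) (auto simp: fresh_def glue_def)
    moreover have "insert e' D - {e} = D" using True D_simps by auto
    ultimately show ?thesis by simp
  next
    case False
    then have eD: "e \<in> D" "en e = {x, y}" using e D(1) by (auto simp: fresh_def)
    have "D \<union> F - {e} = D - {e} \<union> F" using eD D_simps by auto
    then have "even (nb (glue x y en) (D - {e} \<union> F))" using G(5)[of e x y] eD by simp
    moreover have "insert e' D - {e} = insert e' (D - {e})" using False by auto
    ultimately show ?thesis using glue_minus[OF eD a] eD by simp
  qed
  fix A B x y
  assume AB: "A \<union> B = insert e' D" "A \<inter> B = {}" "2 \<le> card A" "2 \<le> card B" "x \<noteq> y"
    "vs en' A \<inter> vs en' B = {x, y}"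
  have *: "parity en' A B x y \<and> parity en' B A x y" if AB: "A \<union> B = insert e' D" "A \<inter> B = {}" "2 \<le> card A" "2 \<le> card B"
    "vs en' A \<inter> vs en' B = {x, y}" and e': "e' \<in> B" for A B
  proof -
    define C where "C = B - {e'}"
    have C: "B = insert e' C" "e' \<notin> C" using e' by (auto simp: C_def)
    have "A \<union> C = insert e' D - {e'}" unfolding AB(1)[symmetric] using C AB(2) by auto
    then have AC: "A \<union> C = D" "A \<inter> C = {}" using D_simps AB(2) C by auto
    then have sub: "A \<subseteq> D" "C \<subseteq> D" by auto
    have fin: "finite A" "finite C" using sub D_simps finite_subset by auto
    have card: "card F = 4" using distinct by simp
    have i: "vs en A \<inter> vs en (C \<union> F) = {x, y}" using vs_expand[OF sub] AB(5) C by simp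
    have "4 \<le> card (C \<union> F)" using card_mono[of "C \<union> F" F] fin card by simp
    then have CF: "2 \<le> card (C \<union> F)" by simp
    have u1: "A \<union> (C \<union> F) = D \<union> F" "(C \<union> F) \<union> A = D \<union> F" using AC by auto
    have u2: "A \<inter> (C \<union> F) = {}" "(C \<union> F) \<inter> A = {}" using AC sub D_simps(3) by auto
    have "parity en A (C \<union> F) x y" "parity en (C \<union> F) A x y"
      using G(6)[OF u1(1) u2(1) AB(3) CF \<open>x \<noteq> y\<close> i] G(6)[OF u1(2) u2(2) CF AB(3) \<open>x \<noteq> y\<close>] i
      by (auto simp: Int_commute)
    moreover have "A \<noteq> {}" "C \<noteq> {}" using AB(3,4) C by auto
    ultimately show ?thesis using parity_expand[of A C x y] AC AB(5) C by simp
  qed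
  have "e' \<in> A \<or> e' \<in> B" using AB(1) by auto
  then show "parity en' A B x y"
    using *[OF AB(1-4,6)] *[of B A] AB by (auto simp: Un_commute Int_commute)
qed

end

section \<open>Expansions preserve the parity conditions\<close>

lemma insep_double: "en g = {a, w} \<Longrightarrow> en h = {a, w} \<Longrightarrow> a \<noteq> w \<Longrightarrow> insep en {g, h}"
  by (intro insep_multi_edge[of _ a w]) auto

text \<open>These are all counts needed around \<open>w\<close>. Gluing \<open>w\<close> to
  \<open>a\<close> turns \<open>g1\<close> and \<open>g2\<close> into loops, each a block, and turns
  the pendant pair \<open>h1\<close>, \<open>h2\<close> into edges with both ends on
  \<open>D\<close>, which no longer form a separate block. The last count is that of contracting
  \<open>g2\<close>: one loop and one further block.\<close>

lemma pendant_double: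
  assumes D: "insep en D" "finite D" "a \<noteq> b" "{a, b} \<subseteq> vs en D" "w \<notin> vs en D"
    and g: "en g1 = {w, a}" "en g2 = {w, a}" "g1 \<noteq> g2" "g1 \<notin> D" "g2 \<notin> D"
    and h: "en h1 = {w, b}" "en h2 = {w, b}" "h1 \<noteq> h2" "h1 \<notin> D" "h2 \<notin> D"
    and gh: "{g1, g2} \<inter> {h1, h2} = {}"
  shows "nb en {g1, g2} = 1" "nb (glue a w en) {g1, g2} = 2"
    "nb en (D \<union> {h1, h2}) = 2" "nb (glue a w en) (D \<union> {h1, h2}) = 1"
    "nb (glue a w en) (insert g1 (D \<union> {h1, h2})) = 2"
proof -
  have wab: "w \<noteq> a" "w \<noteq> b" using D by auto
  show "nb en {g1, g2} = 1"
    using insep_double[of en g1 a w g2] g wab by (intro nb_insep) (auto simp: insert_commute)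
  have loop: "glue a w en g1 = {a}" "glue a w en g2 = {a}" using g by (auto simp: glue_def merge_def)
  have "nb (glue a w en) ({g1} \<union> {g2}) = nb (glue a w en) {g1} + nb (glue a w en) {g2}"
    using loop g by (intro nb_Un[of _ _ _ a]) auto
  then show "nb (glue a w en) {g1, g2} = 2"
    by (simp add: nb_insep insep_singleton insert_commute)
  have "nb en (D \<union> {h1, h2}) = nb en D + nb en {h1, h2}"
    using D h by (intro nb_Un[of _ _ _ b]) auto
  then show "nb en (D \<union> {h1, h2}) = 2"
    using insep_double[of en h1 b w h2] h wab D by (simp add: nb_insep insert_commute)
  have gD: "glue a w en e = en e" if "e \<in> D" for e
    using that D(5) by (auto simp: glue_def merge_def vs_def)
  have DD: "insep (glue a w en) D" using D(1) insep_cong[of D "glue a w en" en] gD by simp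
  have vD: "vs (glue a w en) D = vs en D" using gD by (intro vs_cong) auto
  have gh': "glue a w en h1 = {a, b}" "glue a w en h2 = {a, b}"
    using h wab D(3) by (auto simp: glue_def merge_def)
  have "insep (glue a w en) (insert h2 D)"
    using insep_insert[OF DD h(5) gh'(2) D(3)] D(4) vD by simp
  then have ins: "insep (glue a w en) (insert h1 (insert h2 D))"
    using insep_insert[of "glue a w en" "insert h2 D" h1, OF _ _ gh'(1) D(3)] h(3,4) D(4) vD by auto
  then show "nb (glue a w en) (D \<union> {h1, h2}) = 1" by (simp add: nb_insep)
  have "nb (glue a w en) ({g1} \<union> insert h1 (insert h2 D))
      = nb (glue a w en) {g1} + nb (glue a w en) (insert h1 (insert h2 D))"
  proof (rule nb_Un)
    show "{g1} \<inter> insert h1 (insert h2 D) = {}" using gh g(4) by auto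
  qed (use loop D(2) in auto)
  then show "nb (glue a w en) (insert g1 (D \<union> {h1, h2})) = 2"
    using ins by (simp add: nb_insep insep_singleton insert_commute)
qed

context twoconn_expansion
begin

lemma insep_path:
  assumes "i \<in> {f1, f2}" "j \<in> {f3, f4}"
  shows "insep en (D \<union> {i, j})"
  using assms distinct D(2) en w uv D_simps by (intro insep_path2[where u = u and v = v and w = w]) auto

lemma insep_triple:
  assumes "i \<in> {f1, f2}" "j \<in> {f3, f4}" "k \<in> F" "k \<noteq> i" "k \<noteq> j"
  shows "insep en (insert k (D \<union> {i, j}))"
proof -
  have "en k = {w, u} \<or> en k = {w, v}" using assms(3) en by auto
  then obtain t where t: "en k = {w, t}" "w \<noteq> t" "t \<in> {u, v}" using w by auto
  have "{w, t} \<subseteq> vs en (D \<union> {i, j})" using t(3) assms(1,2) en by auto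
  moreover have "k \<notin> D \<union> {i, j}" using assms D_simps(3) by auto
  ultimately show ?thesis using insep_insert[OF insep_path[OF assms(1,2)] _ t(1,2)] by blast
qed

text \<open>Of the three remaining new edges, two form an ear of \<open>D\<close> through
  \<open>w\<close>, and the third joins vertices that are already present.\<close>

lemma insep_minus_new:
  assumes "f \<in> F" shows "insep en (D \<union> F - {f})"
proof -
  note d = distinct D_simps
  have "D \<union> F - {f1} = insert f4 (D \<union> {f2, f3})" "D \<union> F - {f2} = insert f4 (D \<union> {f1, f3})"
    "D \<union> F - {f3} = insert f2 (D \<union> {f1, f4})" "D \<union> F - {f4} = insert f2 (D \<union> {f1, f3})"
    using d by auto
  moreover have "insep en (insert f4 (D \<union> {f2, f3}))" "insep en (insert f4 (D \<union> {f1, f3}))"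
    "insep en (insert f2 (D \<union> {f1, f4}))" "insep en (insert f2 (D \<union> {f1, f3}))"
    by (rule insep_triple; use distinct in auto)+
  ultimately have "insep en (D \<union> F - {f1})" "insep en (D \<union> F - {f2})"
    "insep en (D \<union> F - {f3})" "insep en (D \<union> F - {f4})"
    by (simp_all only:)
  then show ?thesis using assms by blast
qed

lemma pendants:
  "nb en {f1, f2} = 1" "nb (glue u w en) {f1, f2} = 2"
  "nb en (D \<union> {f3, f4}) = 2" "nb (glue u w en) (D \<union> {f3, f4}) = 1"
  "nb (glue u w en) (insert f1 (D \<union> {f3, f4})) = 2" "nb (glue u w en) (insert f2 (D \<union> {f3, f4})) = 2"
  "nb en {f3, f4} = 1" "nb (glue v w en) {f3, f4} = 2"
  "nb en (D \<union> {f1, f2}) = 2" "nb (glue v w en) (D \<union> {f1, f2}) = 1"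
  "nb (glue v w en) (insert f3 (D \<union> {f1, f2})) = 2" "nb (glue v w en) (insert f4 (D \<union> {f1, f2})) = 2"
proof -
  have d: "f1 \<noteq> f2" "f2 \<noteq> f1" "f3 \<noteq> f4" "f4 \<noteq> f3"
    "{f1, f2} \<inter> {f3, f4} = {}" "{f2, f1} \<inter> {f3, f4} = {}"
    "{f3, f4} \<inter> {f1, f2} = {}" "{f4, f3} \<inter> {f1, f2} = {}"
    using distinct by auto
  have vu: "{v, u} \<subseteq> vs en D" using uv(2) by auto
  note pu = pendant_double[OF D(2) D_simps(1) uv D_simps(4)]
  note pv = pendant_double[OF D(2) D_simps(1) uv(1)[symmetric] vu D_simps(4)]
  note p1 = pu[OF en(1,2) d(1) D_simps(5,6) en(3,4) d(3) D_simps(7,8) d(5)]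
  note p2 = pu[OF en(2,1) d(2) D_simps(6,5) en(3,4) d(3) D_simps(7,8) d(6)]
  note p3 = pv[OF en(3,4) d(3) D_simps(7,8) en(1,2) d(1) D_simps(5,6) d(7)]
  note p4 = pv[OF en(4,3) d(4) D_simps(8,7) en(1,2) d(1) D_simps(5,6) d(8)]
  show "nb en {f1, f2} = 1" "nb (glue u w en) {f1, f2} = 2"
    "nb en (D \<union> {f3, f4}) = 2" "nb (glue u w en) (D \<union> {f3, f4}) = 1"
    "nb (glue u w en) (insert f1 (D \<union> {f3, f4})) = 2" by (fact p1)+
  show "nb (glue u w en) (insert f2 (D \<union> {f3, f4})) = 2" by (fact p2)
  show "nb en {f3, f4} = 1" "nb (glue v w en) {f3, f4} = 2"
    "nb en (D \<union> {f1, f2}) = 2" "nb (glue v w en) (D \<union> {f1, f2}) = 1"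
    "nb (glue v w en) (insert f3 (D \<union> {f1, f2})) = 2" by (fact p3)+
  show "nb (glue v w en) (insert f4 (D \<union> {f1, f2})) = 2" by (fact p4)
qed

lemma even_contract_new:
  assumes "f \<in> F" "en f = {x, y}"
  shows "even (nb (glue x y en) (D \<union> F - {f}))"
proof -
  have "D \<union> F - {f1} = insert f2 (D \<union> {f3, f4})" "D \<union> F - {f2} = insert f1 (D \<union> {f3, f4})"
    "D \<union> F - {f3} = insert f4 (D \<union> {f1, f2})" "D \<union> F - {f4} = insert f3 (D \<union> {f1, f2})"
    using distinct D_simps by auto
  then have "nb (glue u w en) (D \<union> F - {f1}) = 2" "nb (glue u w en) (D \<union> F - {f2}) = 2"
    "nb (glue v w en) (D \<union> F - {f3}) = 2" "nb (glue v w en) (D \<union> F - {f4}) = 2"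
    by (simp_all only: pendants)
  then have gl: "f \<in> {f1, f2} \<Longrightarrow> nb (glue u w en) (D \<union> F - {f}) = 2"
    "f \<in> {f3, f4} \<Longrightarrow> nb (glue v w en) (D \<union> F - {f}) = 2"
    by auto
  have "f \<in> {f1, f2} \<or> f \<in> {f3, f4}" using assms(1) by auto
  then show ?thesis
  proof
    assume f: "f \<in> {f1, f2}"
    then have "{x, y} = {w, u}" using assms(2) en by auto
    then show ?thesis using gl(1)[OF f] nb_glue_commute[of w u en] by (auto simp: doubleton_eq_iff)
  next
    assume f: "f \<in> {f3, f4}"
    then have "{x, y} = {w, v}" using assms(2) en by auto
    then show ?thesis using gl(2)[OF f] nb_glue_commute[of w v en] by (auto simp: doubleton_eq_iff)
  qed
qed

text \<open>The separations that cut through \<open>w\<close> leave one pair of twins as a side. The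
  twins count 1 and, glued, 2; the other side counts 2 and, glued, 1.\<close>

lemma parity_pendant:
  assumes "B = {f1, f2} \<and> A = D \<union> {f3, f4} \<or> B = {f3, f4} \<and> A = D \<union> {f1, f2}"
    and xy: "vs en A \<inter> vs en B = {x, y}"
  shows "parity en A B x y \<and> parity en B A x y"
  using assms(1)
proof (elim disjE conjE)
  assume *: "B = {f1, f2}" "A = D \<union> {f3, f4}"
  have "{x, y} = {u, w}" unfolding xy[symmetric] * using en uv w D_simps by auto
  moreover have "parity en A B u w" "parity en B A u w"
    by (simp_all add: parity_def * pendants del: Un_insert_right)
  ultimately show ?thesis using parity_commute_ends[of en] by (auto simp: doubleton_eq_iff)
next
  assume *: "B = {f3, f4}" "A = D \<union> {f1, f2}"
  have "{x, y} = {v, w}" unfolding xy[symmetric] * using en uv w D_simps by auto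
  moreover have "parity en A B v w" "parity en B A v w"
    by (simp_all add: parity_def * pendants del: Un_insert_right)
  ultimately show ?thesis using parity_commute_ends[of en] by (auto simp: doubleton_eq_iff)
qed

text \<open>\<open>F\<close> has two blocks, and only one after gluing, when its four edges become
  parallel. \<open>D\<close> has one block, and its even glued count is condition (b') for
  \<open>e'\<close>.\<close>

lemma parity_new:
  assumes ev: "even (nb (glue x y en) D)" and xy: "{x, y} = {u, v}"
  shows "parity en D F x y \<and> parity en F D x y"
proof -
  have "nb en ({f1, f2} \<union> {f3, f4}) = nb en {f1, f2} + nb en {f3, f4}"
    using distinct en uv w by (intro nb_Un[of _ _ _ w]) auto
  moreover have "nb en {f1, f2} = 1" "nb en {f3, f4} = 1"
    by (rule pendants)+
  moreover have "{f1, f2} \<union> {f3, f4} = F" by auto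
  ultimately have F: "nb en F = 2" by simp
  have "{x, y} \<subseteq> vs en D" using uv xy by simp
  then have wxy: "w \<noteq> x" "w \<noteq> y" using D_simps by auto
  have "merge x y u = merge x y v" using xy by (auto simp: merge_def doubleton_eq_iff)
  then have "insep (glue x y en) F"
    using edge_expansion.insep_F[OF glue_expansion[OF wxy]] by simp
  then have "nb (glue x y en) F = 1" by (rule nb_insep)
  then show ?thesis using ev F nb_insep[OF D(2)] by (simp add: parity_def)
qed

theorem Phi_edges_expand:
  assumes G: "Phi_edges en' (insert e' D)"
  shows "Phi_edges en (D \<union> F)"
  unfolding Phi_edges_def
proof (intro conjI ballI allI impI; (elim conjE)?)
  note G = Phi_edgesD[OF G]
  show "finite (D \<union> F)" using D_simps by simp
  show "card (en e) = 2" if "e \<in> D \<union> F" for e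
    using that D en w by auto
  show "insep en (D \<union> F)" using insep_expand[OF D(1) _ G(3)] D_minus by auto
  have a: "insep en' (insert e' (D - {e}))" if "e \<in> D" for e
  proof -
    have "insert e' D - {e} = insert e' (D - {e})" using that D_simps by auto
    then show ?thesis using G(4)[of e] that by simp
  qed
  have DF: "D \<union> F - {e} = D - {e} \<union> F" if "e \<in> D" for e using that D_simps by auto
  show "insep en (D \<union> F - {e})" if "e \<in> D \<union> F" for e
  proof (cases "e \<in> D")
    case True
    then show ?thesis using insep_minus_iff[of e] a DF by simp
  next
    case False
    then show ?thesis using insep_minus_new[of e] that by simp
  qed
  show "even (nb (glue x y en) (D \<union> F - {e}))" if e: "e \<in> D \<union> F" "en e = {x, y}" for e x y
  proof (cases "e \<in> D")
    case True
    have "en' e = {x, y}" using e True D(1) by (auto simp: fresh_def)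
    moreover have "insert e' D - {e} = insert e' (D - {e})" using True D_simps by auto
    ultimately show ?thesis
      using glue_minus[OF True e(2) a[OF True]] G(5)[of e x y] True DF[OF True] by simp
  next
    case False
    then show ?thesis using even_contract_new e by auto
  qed
  have evD: "even (nb (glue x y en) D)" if "{x, y} = {u, v}" for x y
  proof -
    have "insert e' D - {e'} = D" using D_simps by auto
    then have "even (nb (glue x y en') D)" using G(5)[of e' x y] en' that by simp
    moreover have "nb (glue x y en) D = nb (glue x y en') D"
      using D(1) by (intro nb_cong) (auto simp: fresh_def glue_def)
    ultimately show ?thesis by simp
  qed
  fix A B x y
  assume AB: "A \<union> B = D \<union> F" "A \<inter> B = {}" "2 \<le> card A" "2 \<le> card B" "x \<noteq> y"
    "vs en A \<inter> vs en B = {x, y}"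
  have one_side: "parity en A B x y \<and> parity en B A x y"
    if AB: "A \<union> B = D \<union> F" "A \<inter> B = {}" "2 \<le> card A" "vs en A \<inter> vs en B = {x, y}"
      and F: "F \<subseteq> B" for A B
  proof -
    define C where "C = B - F"
    have C: "B = C \<union> F" "C \<inter> F = {}" using F by (auto simp: C_def)
    have "A \<union> C = D \<union> F - F" unfolding AB(1)[symmetric] using C AB(2) by auto
    also have "\<dots> = D" using D_simps by auto
    finally have AC: "A \<union> C = D" "A \<inter> C = {}" using C AB(2) by auto
    then have sub: "A \<subseteq> D" "C \<subseteq> D" by auto
    show ?thesis
    proof (cases "C = {}")
      case True
      then have *: "A = D" "B = F" using AC C by auto
      then have "{x, y} = {u, v}" using AB(4) vs_F D_simps uv by auto
      then show ?thesis using parity_new evD * by simp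
    next
      case False
      have e'C: "e' \<notin> C" using sub D_simps by auto
      have fin: "finite C" using sub D_simps finite_subset by auto
      have i: "vs en' A \<inter> vs en' (insert e' C) = {x, y}" using AB(4) C vs_expand[OF sub] by simp
      have "0 < card C" using fin False by (simp add: card_gt_0_iff)
      then have c: "2 \<le> card (insert e' C)" using e'C fin by simp
      have u1: "A \<union> insert e' C = insert e' D" "insert e' C \<union> A = insert e' D" using AC by auto
      have u2: "A \<inter> insert e' C = {}" "insert e' C \<inter> A = {}" using AC sub D_simps by auto
      have "parity en' A (insert e' C) x y" "parity en' (insert e' C) A x y"
        using G(6)[OF u1(1) u2(1) AB(3) c \<open>x \<noteq> y\<close> i] G(6)[OF u1(2) u2(2) c AB(3) \<open>x \<noteq> y\<close>] i
        by (auto simp: Int_commute)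
      moreover have "A \<noteq> {}" using AB(3) by auto
      ultimately show ?thesis using parity_expand[of A C x y] AC i C False by simp
    qed
  qed
  have split: "parity en A B x y \<and> parity en B A x y"
    if AB: "A \<union> B = D \<union> F" "A \<inter> B = {}" "2 \<le> card B" "vs en A \<inter> vs en B = {x, y}"
      and F: "A \<inter> F \<noteq> {}" "D \<inter> B = {}" for A B
  proof -
    have "B \<subseteq> D \<union> F" unfolding AB(1)[symmetric] by auto
    then have BF: "B \<subseteq> F" using F by auto
    have "A = (A \<union> B) - B" using AB(2) by auto
    then have A: "A = D \<union> (F - B)" unfolding AB(1) using F(2) by auto
    obtain f where "f \<in> A" "f \<in> F" using F by blast
    then have wA: "w \<in> vs en A" using ends_subset_vs[of f A en] en by auto
    have uvA: "{u, v} \<subseteq> vs en A" unfolding A using uv by auto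
    \<comment> \<open>Otherwise the three vertices \<open>w\<close>, \<open>u\<close> and
      \<open>v\<close> would all be shared by the two sides.\<close>
    have "\<not> (B \<inter> {f1, f2} \<noteq> {} \<and> B \<inter> {f3, f4} \<noteq> {})"
    proof
      assume "B \<inter> {f1, f2} \<noteq> {} \<and> B \<inter> {f3, f4} \<noteq> {}"
      then obtain i j where "i \<in> B" "i \<in> {f1, f2}" "j \<in> B" "j \<in> {f3, f4}" by blast
      then have "{w, u, v} \<subseteq> vs en B"
        using ends_subset_vs[of i B en] ends_subset_vs[of j B en] en by auto
      then have "{w, u, v} \<subseteq> {x, y}" unfolding AB(4)[symmetric] using wA uvA by auto
      then show False using w uv by auto
    qed
    then have "B \<subseteq> {f1, f2} \<or> B \<subseteq> {f3, f4}" using BF by auto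
    then have "B = {f1, f2} \<or> B = {f3, f4}"
      using AB(3) distinct card_seteq[of "{f1, f2}" B] card_seteq[of "{f3, f4}" B] by auto
    then have "B = {f1, f2} \<and> A = D \<union> {f3, f4} \<or> B = {f3, f4} \<and> A = D \<union> {f1, f2}"
      using A distinct by auto
    then show ?thesis using parity_pendant AB(4) by blast
  qed
  consider "F \<subseteq> B" | "F \<subseteq> A" | "A \<inter> F \<noteq> {}" "B \<inter> F \<noteq> {}"
    using AB(1) by blast
  then show "parity en A B x y"
  proof cases
    case 1
    then show ?thesis using one_side[OF AB(1-3,6)] by simp
  next
    case 2
    then show ?thesis using one_side[of B A] AB by (simp add: Un_commute Int_commute)
  next
    case 3
    obtain i j where "i \<in> A" "i \<in> F" "j \<in> B" "j \<in> F" using 3 by blast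
    then have "w \<in> vs en A \<inter> vs en B"
      using ends_subset_vs[of i A en] ends_subset_vs[of j B en] en by auto
    then have "w \<in> {x, y}" using AB(6) by simp
    then obtain o' where o': "{x, y} = {w, o'}" by auto
    \<comment> \<open>\<open>w\<close> is one of the two shared vertices and lies on no edge of
      \<open>D\<close>, so dividing \<open>D\<close> would leave \<open>o'\<close> as the only
      vertex shared by its parts.\<close>
    have "D \<inter> A = {} \<or> D \<inter> B = {}"
    proof (rule ccontr)
      assume "\<not> (D \<inter> A = {} \<or> D \<inter> B = {})"
      then have ne: "D \<inter> A \<noteq> {}" "D \<inter> B \<noteq> {}" by auto
      have "D \<subseteq> A \<union> B" unfolding AB(1) by (rule Un_upper1)
      then have "\<not> vs en (D \<inter> A) \<inter> vs en (D \<inter> B) \<subseteq> {o'}"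
        using ne AB(2) by (intro insepD[OF D(2)]) auto
      moreover have "vs en (D \<inter> A) \<subseteq> vs en A" "vs en (D \<inter> B) \<subseteq> vs en B" "vs en (D \<inter> A) \<subseteq> vs en D"
        by (auto intro!: vs_mono)
      moreover have "w \<notin> vs en D" using D_simps by simp
      ultimately show False using AB(6) o' by auto
    qed
    then show ?thesis
    proof
      assume "D \<inter> B = {}"
      then show ?thesis using split[OF AB(1,2,4,6)] 3 by simp
    next
      assume "D \<inter> A = {}"
      then show ?thesis using split[of B A] AB 3 by (simp add: Un_commute Int_commute)
    qed
  qed
qed

end

section \<open>Minimal separable sides of 2-separations\<close>

text \<open>If one half contained both attachment vertices, the other half could be cut off from
  everything else at \<open>z\<close>. So each half has exactly one of them; the halves must also
  share a vertex, since otherwise each would be attached at one vertex only.\<close>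

lemma chain_split:
  assumes E: "insep en (P \<union> R)" "P \<inter> R = {}" "R \<noteq> {}" "P \<noteq> {}"
    and PR: "vs en P \<inter> vs en R = {x, y}" and n: "\<not> insep en P"
  obtains A B c where "P = A \<union> B" "A \<inter> B = {}" "A \<noteq> {}" "B \<noteq> {}" "vs en A \<inter> vs en B = {c}"
    "c \<notin> {x, y}" "vs en A \<inter> vs en R = {x}" "vs en B \<inter> vs en R = {y}"
proof -
  obtain A B z where AB: "A \<union> B = P" "A \<inter> B = {}" "A \<noteq> {}" "B \<noteq> {}" and z: "vs en A \<inter> vs en B \<subseteq> {z}"
    using insepE[OF E(4) n] .
  have VP: "vs en P = vs en A \<union> vs en B" using AB(1) vs_simps(3)[of en A B] by simp
  have nA: "\<not> vs en A \<inter> vs en (B \<union> R) \<subseteq> {t}" for t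
    by (rule insepD[OF E(1)]) (use AB E in auto)
  have nB: "\<not> vs en B \<inter> vs en (A \<union> R) \<subseteq> {t}" for t
    by (rule insepD[OF E(1)]) (use AB E in auto)
  have AR: "vs en A \<inter> vs en R \<subseteq> {x, y}" "vs en B \<inter> vs en R \<subseteq> {x, y}" using PR VP by auto
  have xyR: "x \<in> vs en R" "y \<in> vs en R" "x \<in> vs en A \<union> vs en B" "y \<in> vs en A \<union> vs en B"
    using PR VP by auto
  have "\<not> {x, y} \<subseteq> vs en B"
  proof
    assume "{x, y} \<subseteq> vs en B"
    then have "vs en A \<inter> vs en (B \<union> R) \<subseteq> {z}" using AR z by auto
    then show False using nA by simp
  qed
  moreover have "\<not> {x, y} \<subseteq> vs en A"
  proof
    assume "{x, y} \<subseteq> vs en A"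
    then have "vs en B \<inter> vs en (A \<union> R) \<subseteq> {z}" using AR z by auto
    then show False using nB by simp
  qed
  ultimately have cases: "x \<in> vs en A \<and> x \<notin> vs en B \<and> y \<in> vs en B \<and> y \<notin> vs en A \<or>
    x \<in> vs en B \<and> x \<notin> vs en A \<and> y \<in> vs en A \<and> y \<notin> vs en B" using xyR by auto
  then have "\<not> vs en A \<inter> vs en B \<subseteq> {}" using nA[of x] nA[of y] AR by auto
  then have zz: "vs en A \<inter> vs en B = {z}" using z by auto
  then have zxy: "z \<notin> {x, y}" using cases by auto
  show thesis
    using cases
  proof
    assume "x \<in> vs en A \<and> x \<notin> vs en B \<and> y \<in> vs en B \<and> y \<notin> vs en A"
    then have "vs en A \<inter> vs en R = {x}" "vs en B \<inter> vs en R = {y}" using AR xyR by auto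
    then show thesis using that[of A B z] AB zz zxy by simp
  next
    assume "x \<in> vs en B \<and> x \<notin> vs en A \<and> y \<in> vs en A \<and> y \<notin> vs en B"
    then have "vs en B \<inter> vs en R = {x}" "vs en A \<inter> vs en R = {y}" using AR xyR by auto
    then show thesis using that[of B A z] AB zz zxy by (simp add: Un_commute Int_commute)
  qed
qed

lemma two_le_card_Un:
  assumes "finite A" "finite B" "A \<noteq> {}" "B \<noteq> {}" "A \<inter> B = {}"
  shows "2 \<le> card (A \<union> B)"
proof -
  have "0 < card A" "0 < card B" using assms by (simp_all add: card_gt_0_iff)
  then show ?thesis using assms by (simp add: card_Un_disjoint)
qed

text \<open>\<open>P2 \<union> P3\<close> is inseparable by \<open>insep_parallel\<close> and so has
  one block. The parity condition then makes the count of \<open>P1\<close> even, hence different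
  from one.\<close>

lemma Phi_parallel_not_insep:
  assumes G: "Phi_edges en (P1 \<union> P2 \<union> P3)"
    and dj: "P1 \<inter> P2 = {}" "P1 \<inter> P3 = {}" "P2 \<inter> P3 = {}"
    and ne: "2 \<le> card P1" "P2 \<noteq> {}" "P3 \<noteq> {}"
    and xy: "x \<noteq> y" "vs en P1 \<inter> vs en (P2 \<union> P3) = {x, y}" "vs en P2 \<inter> vs en P3 = {x, y}"
  shows "\<not> insep en P1"
proof
  assume P1: "insep en P1"
  note G = Phi_edgesD[OF G]
  have "insep en (P2 \<union> P3)"
    using insep_parallel[OF G(3) _ ne(2,3) dj, of x y] xy ne(1) by fastforce
  then have nb: "nb en (P2 \<union> P3) = 1" by (rule nb_insep)
  have fin: "finite P2" "finite P3" using G(1) by auto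
  have "2 \<le> card (P2 \<union> P3)"
    using two_le_card_Un fin ne(2,3) dj(3) by auto
  then have "parity en P1 (P2 \<union> P3) x y"
    using G(6)[of P1 "P2 \<union> P3" x y] dj ne xy by (simp add: Un_assoc Int_Un_distrib)
  then show False using nb nb_insep[OF P1] by (simp add: parity_def)
qed

text \<open>The separable sides of 2-separations to which (c') applies. A smallest one turns out to
  be the set of four new edges of an expansion.\<close>

definition decomposable :: "('e \<Rightarrow> 'v set) \<Rightarrow> 'e set \<Rightarrow> 'e set \<Rightarrow> bool" where
  "decomposable en E P \<longleftrightarrow> P \<subseteq> E \<and> 2 \<le> card P \<and> 2 \<le> card (E - P) \<and> \<not> insep en P \<and>
     (\<exists>x y. x \<noteq> y \<and> vs en P \<inter> vs en (E - P) = {x, y})"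

lemma parallel_decomposable:
  assumes G: "Phi_edges en (P1 \<union> P2 \<union> P3)"
    and dj: "P1 \<inter> P2 = {}" "P1 \<inter> P3 = {}" "P2 \<inter> P3 = {}"
    and ne: "2 \<le> card P1" "P2 \<noteq> {}" "P3 \<noteq> {}"
    and xy: "x \<noteq> y" "vs en P1 \<inter> vs en (P2 \<union> P3) = {x, y}" "vs en P2 \<inter> vs en P3 = {x, y}"
  shows "decomposable en (P1 \<union> P2 \<union> P3) P1"
proof -
  have fin: "finite P2" "finite P3" using Phi_edgesD(1)[OF G] by auto
  have "2 \<le> card (P2 \<union> P3)"
    using two_le_card_Un fin ne(2,3) dj(3) by auto
  moreover have "P1 \<union> P2 \<union> P3 - P1 = P2 \<union> P3" using dj by auto
  ultimately show ?thesis
    unfolding decomposable_def using Phi_parallel_not_insep[OF assms] ne xy by auto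
qed

text \<open>By (b'), \<open>E - {e}\<close> with the ends of \<open>e\<close> glued has an even
  count, so it falls into two pieces parallel to \<open>e\<close>. At least three edges are
  distributed over these pieces, so one of them has two edges.\<close>

lemma exists_decomposable:
  assumes G: "Phi_edges en E" and four: "4 \<le> card E"
  shows "\<exists>P. decomposable en E P"
proof -
  note G' = Phi_edgesD[OF G]
  obtain e where e: "e \<in> E" using insep_nonempty[OF G'(3)] by auto
  obtain x y where xy: "en e = {x, y}" "x \<noteq> y" using G'(2)[OF e] by (auto simp: card_2_iff)
  define Q where "Q = E - {e}"
  have Q: "3 \<le> card Q" "finite Q" using four e G'(1) by (auto simp: Q_def)
  then have Qne: "Q \<noteq> {}" by auto
  have EQ: "E = Q \<union> {e}" "e \<notin> Q" using e by (auto simp: Q_def)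
  have "even (nb (glue x y en) Q)" using G'(5)[OF e xy(1)] by (simp add: Q_def)
  then have "\<not> insep (glue x y en) Q" using nb_insep[of "glue x y en" Q] by auto
  then obtain Q1 Q2 where Q12: "Q = Q1 \<union> Q2" "Q1 \<inter> Q2 = {}" "Q1 \<noteq> {}" "Q2 \<noteq> {}" "vs en Q1 \<inter> vs en Q2 = {x, y}"
    using insep_glue_split[of en Q "{e}" x y] G'(3) EQ Qne xy by auto
  have ex: "\<exists>P. decomposable en E P" if Q12: "Q = Q1 \<union> Q2" "Q1 \<inter> Q2 = {}" "Q2 \<noteq> {}"
    "vs en Q1 \<inter> vs en Q2 = {x, y}" and c: "2 \<le> card Q1" for Q1 Q2
  proof -
    have E: "E = Q1 \<union> Q2 \<union> {e}" using EQ Q12 by simp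
    have "{x, y} \<subseteq> vs en Q1" "{x, y} \<subseteq> vs en Q2" unfolding Q12(4)[symmetric] by auto
    then have "decomposable en (Q1 \<union> Q2 \<union> {e}) Q1"
      using G EQ(2) Q12 c xy unfolding E
      by (intro parallel_decomposable[of _ _ _ _ x y]) auto
    then show ?thesis using E by auto
  qed
  have "finite Q1" "finite Q2" using Q(2) Q12(1) by auto
  then have "card Q1 + card Q2 \<ge> 3" using Q(1) Q12 by (simp add: card_Un_disjoint)
  then have "2 \<le> card Q1 \<or> 2 \<le> card Q2" by auto
  then show ?thesis
    using ex[OF Q12(1,2,4,5)] ex[of Q2 Q1] Q12 by (auto simp: Un_commute Int_commute)
qed

text \<open>\<open>A\<close> has one block, so (c') makes its glued count even and \<open>A\<close>
  falls into two parallel pieces. Together with \<open>S\<close> these are three parallel pieces,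
  and one of them inside \<open>A\<close> with two edges would be decomposable and smaller than
  \<open>A\<close>.\<close>

lemma minimal_half_double:
  assumes G: "Phi_edges en (A \<union> S)" and AS: "A \<inter> S = {}" "2 \<le> card A" "2 \<le> card S"
    and xc: "x \<noteq> c" "vs en A \<inter> vs en S = {x, c}" and A: "insep en A"
    and min: "\<And>P. decomposable en (A \<union> S) P \<Longrightarrow> card A \<le> card P"
  obtains a1 a2 where "A = {a1, a2}" "a1 \<noteq> a2" "en a1 = {c, x}" "en a2 = {c, x}"
proof -
  note G' = Phi_edgesD[OF G]
  have fin: "finite A" "finite S" using G'(1) by auto
  have "parity en A S x c" using G'(6)[of A S x c] AS xc by auto
  then have "even (nb (glue x c en) A)" using nb_insep[OF A] by (simp add: parity_def)
  then have "\<not> insep (glue x c en) A" using nb_insep[of "glue x c en" A] by auto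
  moreover have "A \<noteq> {}" "S \<noteq> {}" using AS by auto
  ultimately obtain P1 P2 where P: "A = P1 \<union> P2" "P1 \<inter> P2 = {}" "P1 \<noteq> {}" "P2 \<noteq> {}" "vs en P1 \<inter> vs en P2 = {x, c}"
    using insep_glue_split[OF G'(3) _ _ AS(1), of x c] xc by auto
  have single: "\<exists>a. P1 = {a} \<and> en a = {c, x}" if P: "A = P1 \<union> P2" "P1 \<inter> P2 = {}" "P1 \<noteq> {}" "P2 \<noteq> {}"
    "vs en P1 \<inter> vs en P2 = {x, c}" for P1 P2
  proof -
    have fin': "finite P1" "finite P2" using fin P by auto
    have "\<not> 2 \<le> card P1"
    proof
      assume c: "2 \<le> card P1"
      have sub: "{x, c} \<subseteq> vs en P1" "{x, c} \<subseteq> vs en P2" unfolding P(5)[symmetric] by auto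
      have VA: "vs en A = vs en P1 \<union> vs en P2" using P(1) by simp
      have "{x, c} \<subseteq> vs en S" unfolding xc(2)[symmetric] by auto
      then have "vs en P2 \<inter> vs en S = {x, c}" "vs en P1 \<inter> vs en S = {x, c}"
        using sub xc(2) VA by auto
      moreover have E: "A \<union> S = P1 \<union> P2 \<union> S" using P(1) by auto
      ultimately have "decomposable en (A \<union> S) P1"
        using G AS P c xc(1) \<open>S \<noteq> {}\<close> unfolding E
        by (intro parallel_decomposable[of _ _ _ _ x c]) auto
      then have "card A \<le> card P1" by (rule min)
      moreover have "card A = card P1 + card P2" using P fin' by (simp add: card_Un_disjoint)
      moreover have "card P2 > 0" using P fin' by (simp add: card_gt_0_iff)
      ultimately show False by simp
    qed
    moreover have "card P1 > 0" using P fin' by (simp add: card_gt_0_iff)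
    ultimately have "card P1 = 1" by simp
    then obtain a where a: "P1 = {a}" by (auto simp: card_1_singleton_iff)
    then have "card (en a) = 2" using G'(2)[of a] P by auto
    moreover have "{c, x} \<subseteq> en a" using P(5) a by auto
    moreover have "finite (en a)" using \<open>card (en a) = 2\<close> by (metis card.infinite zero_neq_numeral)
    ultimately have "en a = {c, x}" using card_seteq[of "en a" "{c, x}"] xc(1) by auto
    then show ?thesis using a by auto
  qed
  obtain a1 where a1: "P1 = {a1}" "en a1 = {c, x}" using single[OF P] by auto
  obtain a2 where a2: "P2 = {a2}" "en a2 = {c, x}" using single[of P2 P1] P by (auto simp: Un_commute Int_commute)
  show thesis using that[of a1 a2] a1 a2 P(1,2) by auto
qed

lemma Phi_edges_structure:
  assumes G: "Phi_edges en E" and four: "4 \<le> card E"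
  obtains R a1 a2 b1 b2 x y c where "E = R \<union> {a1, a2, b1, b2}" "distinct [a1, a2, b1, b2]"
    "R \<inter> {a1, a2, b1, b2} = {}" "en a1 = {c, x}" "en a2 = {c, x}" "en b1 = {c, y}" "en b2 = {c, y}"
    "c \<notin> vs en R" "x \<noteq> y" "{x, y} \<subseteq> vs en R" "insep en R" "2 \<le> card R"
proof -
  note G' = Phi_edgesD[OF G]
  obtain P where P: "decomposable en E P" and min: "\<And>P'. decomposable en E P' \<Longrightarrow> card P \<le> card P'"
    using exists_decomposable[OF assms] ex_has_least_nat[of "decomposable en E" _ card] by metis
  obtain x y where xy: "x \<noteq> y" "vs en P \<inter> vs en (E - P) = {x, y}" using P unfolding decomposable_def by auto
  define R where "R = E - P"
  have PR: "E = P \<union> R" "P \<inter> R = {}" "2 \<le> card P" "2 \<le> card R" "\<not> insep en P"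
    using P by (auto simp: decomposable_def R_def)
  have ne: "P \<noteq> {}" "R \<noteq> {}" using PR by auto
  have xyR: "vs en P \<inter> vs en R = {x, y}" using xy by (simp add: R_def)
  have fin: "finite P" "finite R" using G'(1) PR(1) by auto
  obtain A B c where AB: "P = A \<union> B" "A \<inter> B = {}" "A \<noteq> {}" "B \<noteq> {}" "vs en A \<inter> vs en B = {c}"
    "c \<notin> {x, y}" "vs en A \<inter> vs en R = {x}" "vs en B \<inter> vs en R = {y}"
    using chain_split[of en P R x y] G'(3) PR ne xyR by metis
  have half: "\<exists>a1 a2. A = {a1, a2} \<and> a1 \<noteq> a2 \<and> en a1 = {c, x} \<and> en a2 = {c, x}"
    if AB: "P = A \<union> B" "A \<inter> B = {}" "A \<noteq> {}" "B \<noteq> {}" "vs en A \<inter> vs en B = {c}"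
      "c \<notin> {x, y}" "vs en A \<inter> vs en R = {x}" "vs en B \<inter> vs en R = {y}" for A B x y
  proof -
    have fin': "finite A" "finite B" using fin AB by auto
    have E: "E = A \<union> (B \<union> R)" "A \<inter> (B \<union> R) = {}" using PR AB by auto
    have dj: "B \<inter> R = {}" using PR AB by auto
    have cA: "card A > 0" "card B > 0" using AB fin' by (auto simp: card_gt_0_iff)
    \<comment> \<open>Condition (a') enters here: after deleting a half consisting of one edge, the
      other half would hang on \<open>R\<close> at one vertex.\<close>
    have "card A \<noteq> 1"
    proof
      assume "card A = 1"
      then obtain a where a: "A = {a}" by (auto simp: card_1_singleton_iff)
      then have "E - {a} = B \<union> R" using E by auto
      then have "insep en (B \<union> R)" using G'(4)[of a] E(1) a by simp
      then have "\<not> vs en B \<inter> vs en R \<subseteq> {y}" by (rule insepD) (use AB ne dj in auto)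
      then show False using AB by auto
    qed
    then have c2: "2 \<le> card A" using cA by simp
    have c3: "2 \<le> card (B \<union> R)" using card_mono[of "B \<union> R" R] fin fin' PR(4) by simp
    have "card P = card A + card B" using AB(1,2) fin' by (simp add: card_Un_disjoint)
    then have less: "card A < card P" using cA by simp
    have xc: "x \<noteq> c" "vs en A \<inter> vs en (B \<union> R) = {x, c}" using AB by auto
    have EA: "E - A = B \<union> R" using E by auto
    \<comment> \<open>Otherwise \<open>A\<close> itself would be decomposable, with fewer edges than
      \<open>P\<close>.\<close>
    have "insep en A"
    proof (rule ccontr)
      assume "\<not> insep en A"
      moreover have "A \<subseteq> E" using E(1) by auto
      ultimately have "decomposable en E A" unfolding decomposable_def EA using c2 c3 xc by blast
      then show False using min less by fastforce
    qed
    moreover have "card A \<le> card P'" if "decomposable en E P'" for P'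
      using min[OF that] less by simp
    ultimately show ?thesis
      using minimal_half_double[of en A "B \<union> R" x c] G E c2 c3 xc by metis
  qed
  obtain a1 a2 where a: "A = {a1, a2}" "a1 \<noteq> a2" "en a1 = {c, x}" "en a2 = {c, x}"
    using half[OF AB] by auto
  obtain b1 b2 where b: "B = {b1, b2}" "b1 \<noteq> b2" "en b1 = {c, y}" "en b2 = {c, y}"
    using half[of B A y x] AB by (auto simp: Un_commute Int_commute)
  have cxy: "c \<noteq> x" "c \<noteq> y" using AB(6) by auto
  have "nb en P = nb en A + nb en B" unfolding AB(1)
    using AB a b by (intro nb_Un[of _ _ _ c]) auto
  moreover have "nb en A = 1" "nb en B = 1"
    using a b cxy insep_double[of en a1 x c a2] insep_double[of en b1 y c b2]
    by (auto simp: nb_insep insert_commute)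
  \<comment> \<open>Two blocks in \<open>P\<close> force an even glued count of \<open>R\<close> by
    (c'). So \<open>R\<close> falls into two parallel pieces, and \<open>insep_parallel\<close>
    makes their union inseparable.\<close>
  ultimately have "nb en P = 2" by simp
  moreover have "parity en R P x y"
    using G'(6)[of R P x y] PR xy xyR by (auto simp: Un_commute Int_commute)
  ultimately have "even (nb (glue x y en) R)" by (simp add: parity_def)
  then have "\<not> insep (glue x y en) R" using nb_insep[of "glue x y en" R] by auto
  then obtain R1 R2 where R12: "R = R1 \<union> R2" "R1 \<inter> R2 = {}" "R1 \<noteq> {}" "R2 \<noteq> {}" "vs en R1 \<inter> vs en R2 = {x, y}"
    using insep_glue_split[of en R P x y] G'(3) PR ne xyR xy(1) by (auto simp: Un_commute Int_commute)
  have "insep en (R1 \<union> R2)"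
  proof (rule insep_parallel)
    show "insep en (P \<union> R1 \<union> R2)" using G'(3) PR(1) R12(1) by (simp add: Un_assoc)
    show "vs en P \<inter> vs en (R1 \<union> R2) \<subseteq> {x, y}" using xyR R12(1) by simp
    show "P \<inter> R1 = {}" "P \<inter> R2 = {}" using PR(2) R12(1) by auto
  qed (use ne R12 in auto)
  then have insR: "insep en R" using R12 by simp
  have "c \<in> vs en P" using AB(1,5) by auto
  then have "c \<notin> vs en R" using xyR AB(6) by auto
  moreover have "{x, y} \<subseteq> vs en R" unfolding xyR[symmetric] by auto
  moreover have "E = R \<union> {a1, a2, b1, b2}" using PR AB a b by auto
  moreover have "distinct [a1, a2, b1, b2]" using a b AB(2) by auto
  moreover have "R \<inter> {a1, a2, b1, b2} = {}" using PR(2) AB a b by auto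
  ultimately show thesis
    using that[of R a1 a2 b1 b2 c x y] a b insR xy(1) PR(4) by simp
qed

section \<open>From graphs to edge sets\<close>

lemma reach_closed:
  assumes "reach G x y" "x \<in> C" "\<And>s t. s \<in> C \<Longrightarrow> adj G s t \<Longrightarrow> t \<in> C"
  shows "y \<in> C"
proof -
  have "(adj G)\<^sup>*\<^sup>* x y" using assms(1) by (simp add: reach_def)
  then show ?thesis by (induction rule: rtranclp_induct) (use assms in auto)
qed

lemma delete_vertex_simps [simp]:
  "verts (delete_vertex G v) = verts G - {v}"
  "adj (delete_vertex G v) s t \<longleftrightarrow> (\<exists>e\<in>edges G. v \<notin> ends G e \<and> s \<in> ends G e \<and> t \<in> ends G e)"
  by (auto simp: delete_vertex_def adj_def)

lemma reach_step:
  assumes "reach G x y" "adj G y z" "z \<in> verts G"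
  shows "reach G x z"
  using assms by (auto simp: reach_def)

lemma wf_endsD:
  assumes "wf_graph G" "e \<in> edges G"
  shows "ends G e \<subseteq> verts G" "ends G e \<noteq> {}" "finite (ends G e)" "card (ends G e) \<le> 2"
  using assms unfolding wf_graph_def by (auto intro: finite_subset)

lemma wf_vs: "wf_graph G \<Longrightarrow> A \<subseteq> edges G \<Longrightarrow> vs (ends G) A \<subseteq> verts G"
  using wf_endsD(1)[of G] by (auto simp: vs_def)

lemma card2_cases:
  assumes "finite X" "card X \<le> 2" "a \<in> X" "b \<in> X" "c \<in> X" "a \<noteq> b" "a \<noteq> c" shows "b = c"
proof (rule ccontr)
  assume "b \<noteq> c"
  then have "card {a, b, c} = 3" using assms by simp
  moreover have "card {a, b, c} \<le> card X" using assms by (intro card_mono) auto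
  ultimately show False using assms(2) by simp
qed

text \<open>A split sharing at most \<open>z\<close> makes \<open>z\<close> a cut vertex, or
  contradicts connectedness if \<open>z\<close> is no vertex of \<open>G\<close>. This needs a
  vertex other than \<open>z\<close> on each side, which exists because a non-separable graph with
  two edges has no loops.\<close>

lemma nonsep_imp_insep:
  assumes wf: "wf_graph G" and n: "nonsep G" and ne: "edges G \<noteq> {} \<or> 2 \<le> card (verts G)"
  shows "insep (ends G) (edges G) \<and> verts G = vs (ends G) (edges G)"
proof -
  have conn: "reach G x y" if "x \<in> verts G" "y \<in> verts G" for x y
    using n that by (auto simp: nonsep_def connected_graph_def)
  have "verts G \<noteq> {}" using n by (auto simp: nonsep_def connected_graph_def)
  have cov: "x \<in> vs (ends G) (edges G)" if x: "x \<in> verts G" for x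
  proof (rule ccontr)
    assume nx: "x \<notin> vs (ends G) (edges G)"
    have "y \<in> {x}" if "y \<in> verts G" for y
      by (rule reach_closed[OF conn[OF x that]]) (use nx in \<open>auto simp: adj_def vs_def\<close>)
    then have V: "verts G = {x}" using x by blast
    then obtain e where e: "e \<in> edges G" using ne by auto
    then have "x \<in> ends G e" using wf_endsD(1,2)[OF wf e] V by auto
    then show False using nx e by (auto simp: vs_def)
  qed
  have "insep (ends G) (edges G)"
  proof (rule insepI)
    show "edges G \<noteq> {}" using cov \<open>verts G \<noteq> {}\<close> by (auto simp: vs_def)
    fix A B z
    assume AB: "A \<union> B = edges G" "A \<inter> B = {}" "A \<noteq> {}" "B \<noteq> {}"
      and z: "vs (ends G) A \<inter> vs (ends G) B \<subseteq> {z}"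
    obtain a b where ab: "a \<in> A" "b \<in> B" using AB by auto
    then have abE: "a \<in> edges G" "b \<in> edges G" "a \<noteq> b" using AB(1,2) by auto
    have fE: "finite (edges G)" using wf by (simp add: wf_graph_def)
    have "card {a, b} \<le> card (edges G)" using abE fE by (intro card_mono) auto
    then have "card (edges G) \<noteq> 1" using abE by simp
    then have "\<not> is_loop G e" if "e \<in> edges G" for e using n that by (auto simp: nonsep_def)
    then have two: "card (ends G e) = 2" if "e \<in> edges G" for e
      using wf that by (auto simp: wf_graph_def is_loop_def)
    have other: "\<exists>p\<in>ends G e. p \<noteq> z" if "e \<in> edges G" for e
      using two[OF that] by (auto simp: card_2_iff)
    obtain p where p: "p \<in> ends G a" "p \<noteq> z" using other abE by auto
    obtain q where q: "q \<in> ends G b" "q \<noteq> z" using other abE by auto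
    have pq: "p \<in> verts G" "q \<in> verts G" "p \<in> vs (ends G) A" "q \<in> vs (ends G) B"
      using p q ab wf_endsD(1)[OF wf abE(1)] wf_endsD(1)[OF wf abE(2)] by (auto simp: vs_def)
    have inA: "e \<in> A" if "e \<in> edges G" "s \<in> ends G e" "s \<in> vs (ends G) A" "s \<noteq> z" for e s
    proof (rule ccontr)
      assume "e \<notin> A"
      then have "e \<in> B" using that(1) unfolding AB(1)[symmetric] by auto
      then have "s \<in> vs (ends G) B" using that by (auto simp: vs_def)
      then show False using z that by auto
    qed
    show False
    proof (cases "reach (delete_vertex G z) p q")
      case True
      have "q \<in> vs (ends G) A - {z}"
      proof (rule reach_closed[OF True])
        show "p \<in> vs (ends G) A - {z}" using pq p by simp
        fix s t assume s: "s \<in> vs (ends G) A - {z}" and "adj (delete_vertex G z) s t"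
        then obtain e where e: "e \<in> edges G" "z \<notin> ends G e" "s \<in> ends G e" "t \<in> ends G e" by auto
        then have "e \<in> A" using inA s by auto
        then show "t \<in> vs (ends G) A - {z}" using e by (auto simp: vs_def)
      qed
      then show False using z q pq by auto
    next
      case False
      show False
      proof (cases "z \<in> verts G")
        case True
        then have "cut_vertex G z"
          using False p q pq conn[OF pq(1,2)] unfolding cut_vertex_def by blast
        then show False using n by (auto simp: nonsep_def)
      next
        case nz: False
        have "q \<in> vs (ends G) A"
        proof (rule reach_closed[OF conn[OF pq(1,2)] pq(3)])
          fix s t assume s: "s \<in> vs (ends G) A" and "adj G s t"
          then obtain e where e: "e \<in> edges G" "s \<in> ends G e" "t \<in> ends G e" by (auto simp: adj_def)
          then have "s \<noteq> z" using nz wf_endsD(1)[OF wf e(1)] by auto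
          then have "e \<in> A" using inA s e by auto
          then show "t \<in> vs (ends G) A" using e by (auto simp: vs_def)
        qed
        then show False using z q pq by auto
      qed
    qed
  qed
  then show ?thesis using cov wf_vs[OF wf, of "edges G"] by auto
qed

text \<open>The edges reachable from \<open>x\<close>, possibly after deleting \<open>v\<close>,
  share at most one vertex with the remaining edges, so they are all edges. The same argument shows
  that a loop is the only edge.\<close>

lemma insep_imp_nonsep:
  assumes wf: "wf_graph G" and ins: "insep (ends G) (edges G)" and V: "verts G = vs (ends G) (edges G)"
  shows "nonsep G"
proof -
  have cover: "\<exists>e\<in>edges G. x \<in> ends G e" if "x \<in> verts G" for x
    using that V by (auto simp: vs_def)
  have whole: "A = edges G" if "A \<subseteq> edges G" "A \<noteq> {}"
    "vs (ends G) A \<inter> vs (ends G) (edges G - A) \<subseteq> {z}" for A z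
  proof (rule ccontr)
    assume "A \<noteq> edges G"
    then have "\<not> vs (ends G) A \<inter> vs (ends G) (edges G - A) \<subseteq> {z}"
      by (intro insepD[OF ins]) (use that in auto)
    then show False using that by simp
  qed
  have conn: "reach G x y" if x: "x \<in> verts G" and y: "y \<in> verts G" for x y
  proof -
    define A where "A = {e \<in> edges G. \<exists>s\<in>ends G e. reach G x s}"
    have A: "reach G x t" if e: "e \<in> A" "t \<in> ends G e" for e t
    proof -
      obtain s where s: "s \<in> ends G e" "reach G x s" using e by (auto simp: A_def)
      have eE: "e \<in> edges G" using e by (simp add: A_def)
      then show ?thesis using s e wf_endsD(1)[OF wf eE] by (intro reach_step[OF s(2)]) (auto simp: adj_def)
    qed
    have "vs (ends G) A \<inter> vs (ends G) (edges G - A) \<subseteq> {x}"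
      using A by (auto simp: vs_def A_def)
    moreover have "A \<noteq> {}" using cover[OF x] x by (auto simp: A_def reach_def)
    moreover have "A \<subseteq> edges G" by (auto simp: A_def)
    ultimately have "A = edges G" using whole by blast
    then show ?thesis using cover[OF y] A by auto
  qed
  have nocut: "\<not> cut_vertex G v" for v
  proof
    assume "cut_vertex G v"
    then obtain x y where xy: "x \<in> verts G - {v}" "y \<in> verts G - {v}" "\<not> reach (delete_vertex G v) x y"
      by (auto simp: cut_vertex_def)
    let ?r = "reach (delete_vertex G v) x"
    define A where "A = {e \<in> edges G. \<exists>s\<in>ends G e. ?r s}"
    have A: "?r t" if e: "e \<in> A" "t \<in> ends G e" "t \<noteq> v" for e t
    proof -
      obtain s where s: "s \<in> ends G e" "?r s" using e by (auto simp: A_def)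
      have eE: "e \<in> edges G" using e by (simp add: A_def)
      have sv: "s \<noteq> v" using s(2) by (auto simp: reach_def)
      show ?thesis
      proof (cases "v \<in> ends G e")
        case True
        then have "s = t" using card2_cases[OF wf_endsD(3,4)[OF wf eE], of v s t] s e sv by auto
        then show ?thesis using s by simp
      next
        case False
        then show ?thesis using s e eE wf_endsD(1)[OF wf eE] by (intro reach_step[OF s(2)]) auto
      qed
    qed
    have "vs (ends G) A \<inter> vs (ends G) (edges G - A) \<subseteq> {v}"
    proof
      fix t assume t: "t \<in> vs (ends G) A \<inter> vs (ends G) (edges G - A)"
      then obtain e f where ef: "e \<in> A" "t \<in> ends G e" "f \<in> edges G" "f \<notin> A" "t \<in> ends G f"
        by (auto simp: vs_def)
      then have "\<not> ?r t" by (auto simp: A_def)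
      then show "t \<in> {v}" using A ef by auto
    qed
    moreover have "A \<noteq> {}" using cover[of x] xy(1) by (auto simp: A_def reach_def)
    moreover have "A \<subseteq> edges G" by (auto simp: A_def)
    ultimately have "A = edges G" using whole by blast
    then show False using cover[of y] A xy by auto
  qed
  have loops: "card (verts G) = 1 \<and> card (edges G) = 1" if l: "l \<in> edges G" "is_loop G l" for l
  proof -
    obtain x where x: "ends G l = {x}" using l(2) by (auto simp: is_loop_def card_1_singleton_iff)
    then have "{l} = edges G" using l by (intro whole[of _ x]) auto
    then have E: "edges G = {l}" by simp
    then have "verts G = {x}" unfolding V using x by simp
    then show ?thesis using E by simp
  qed
  obtain e where "e \<in> edges G" using insep_nonempty[OF ins] by auto
  then have "verts G \<noteq> {}" using wf_endsD(1,2)[OF wf] by blast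
  then show ?thesis using conn nocut loops by (auto simp: nonsep_def connected_graph_def)
qed

text \<open>The second hypothesis excludes the graph with one vertex and no edges, which is
  non-separable although the empty edge set is not inseparable.\<close>

lemma nonsep_iff_insep:
  assumes "wf_graph G" "edges G \<noteq> {} \<or> 2 \<le> card (verts G)"
  shows "nonsep G \<longleftrightarrow> insep (ends G) (edges G) \<and> verts G = vs (ends G) (edges G)"
  using nonsep_imp_insep insep_imp_nonsep assms by blast

section \<open>Blocks as maximal inseparable edge sets\<close>

definition edge_subgraph :: "('v, 'e) graph \<Rightarrow> 'e set \<Rightarrow> ('v, 'e) graph" where
  "edge_subgraph G S = \<lparr>verts = vs (ends G) S, edges = S, ends = (\<lambda>e. if e \<in> S then ends G e else {})\<rparr>"

lemma edge_subgraph_simps [simp]: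
  "verts (edge_subgraph G S) = vs (ends G) S" "edges (edge_subgraph G S) = S"
  "ends (edge_subgraph G S) e = (if e \<in> S then ends G e else {})"
  by (simp_all add: edge_subgraph_def)

lemma subgraph_edge_subgraph: "wf_graph G \<Longrightarrow> S \<subseteq> edges G \<Longrightarrow> subgraph (edge_subgraph G S) G"
  using wf_vs by (fastforce simp: subgraph_def edge_subgraph_def vs_def)

lemma edge_subgraph_mono: "S \<subseteq> T \<Longrightarrow> subgraph (edge_subgraph G S) (edge_subgraph G T)"
  by (auto simp: subgraph_def edge_subgraph_def vs_def fun_eq_iff)

lemma wf_subgraph:
  assumes wf: "wf_graph G" and s: "subgraph H G" shows "wf_graph H"
proof -
  have e: "ends H = (\<lambda>e. if e \<in> edges H then ends G e else {})"
    and *: "verts H \<subseteq> verts G" "edges H \<subseteq> edges G" "\<forall>e\<in>edges H. ends G e \<subseteq> verts H"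
    using s by (auto simp: subgraph_def)
  show ?thesis
    using wf * finite_subset unfolding wf_graph_def e by (auto intro: finite_subset)
qed

lemma subgraph_ends: "subgraph H G \<Longrightarrow> e \<in> edges H \<Longrightarrow> ends H e = ends G e"
  unfolding subgraph_def by presburger

lemma nonsep_subgraph_iff:
  assumes wf: "wf_graph G" and s: "subgraph H G" and ne: "edges H \<noteq> {}"
  shows "nonsep H \<longleftrightarrow> insep (ends G) (edges H) \<and> H = edge_subgraph G (edges H)"
proof -
  have "insep (ends H) (edges H) = insep (ends G) (edges H)"
    using subgraph_ends[OF s] by (rule insep_cong)
  moreover have "vs (ends H) (edges H) = vs (ends G) (edges H)"
    using subgraph_ends[OF s] by (rule vs_cong)
  moreover have "verts H = vs (ends G) (edges H) \<longleftrightarrow> H = edge_subgraph G (edges H)"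
    using s by (cases H) (auto simp: edge_subgraph_def subgraph_def)
  ultimately show ?thesis using nonsep_iff_insep[OF wf_subgraph[OF wf s]] ne by simp
qed

text \<open>A non-separable subgraph with an edge is determined by its edge set, and so is every
  non-separable subgraph containing it; hence the two notions of maximality agree.\<close>

lemma blocks_eq:
  assumes wf: "wf_graph G"
  shows "{H. is_block H G \<and> edges H \<noteq> {}} = edge_subgraph G ` parts (ends G) (edges G)"
proof (intro set_eqI iffI)
  fix H assume "H \<in> {H. is_block H G \<and> edges H \<noteq> {}}"
  then have H: "subgraph H G" "nonsep H" "edges H \<noteq> {}"
    and max: "\<And>H'. subgraph H' G \<Longrightarrow> nonsep H' \<Longrightarrow> subgraph H H' \<Longrightarrow> H' = H"
    by (auto simp: is_block_def)
  have HE: "edges H \<subseteq> edges G" using H by (simp add: subgraph_def)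
  have ins: "insep (ends G) (edges H)" and eq: "H = edge_subgraph G (edges H)"
    using nonsep_subgraph_iff[OF wf H(1,3)] H(2) by auto
  have "edges H \<in> parts (ends G) (edges G)"
  proof (rule partsI[OF HE ins])
    fix T assume T: "T \<subseteq> edges G" "insep (ends G) T" "edges H \<subseteq> T"
    have sT: "subgraph (edge_subgraph G T) G" using subgraph_edge_subgraph[OF wf T(1)] .
    then have "nonsep (edge_subgraph G T)"
      using nonsep_subgraph_iff[OF wf sT] T(2) insep_nonempty[OF T(2)] by simp
    moreover have "subgraph H (edge_subgraph G T)"
      using edge_subgraph_mono[OF T(3), of G] unfolding eq[symmetric] .
    ultimately have "edge_subgraph G T = H" using max sT by blast
    then show "T = edges H" by auto
  qed
  then show "H \<in> edge_subgraph G ` parts (ends G) (edges G)" using eq by blast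
next
  fix H assume "H \<in> edge_subgraph G ` parts (ends G) (edges G)"
  then obtain S where S: "S \<in> parts (ends G) (edges G)" "H = edge_subgraph G S" by auto
  note S' = partsD[OF S(1)]
  have sH: "subgraph H G" using subgraph_edge_subgraph[OF wf S'(1)] S(2) by simp
  have "nonsep H" using nonsep_subgraph_iff[OF wf sH] S'(2,3) S(2) by simp
  moreover have "H' = H" if H': "subgraph H' G" "nonsep H'" "subgraph H H'" for H'
  proof -
    have SH': "S \<subseteq> edges H'" "edges H' \<subseteq> edges G" using H' S(2) by (auto simp: subgraph_def)
    then have "edges H' \<noteq> {}" using S'(3) by auto
    then have "insep (ends G) (edges H')" "H' = edge_subgraph G (edges H')"
      using nonsep_subgraph_iff[OF wf H'(1)] H'(2) by auto
    then show ?thesis using S'(4)[OF SH'(2)] SH'(1) S(2) by simp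
  qed
  ultimately show "H \<in> {H. is_block H G \<and> edges H \<noteq> {}}"
    using sH S'(3) S(2) by (auto simp: is_block_def)
qed

lemma nblocks_eq_nb:
  assumes "wf_graph G"
  shows "nblocks G = nb (ends G) (edges G)"
proof -
  have "inj_on (edge_subgraph G) (parts (ends G) (edges G))"
    by (rule inj_onI) (metis edge_subgraph_simps(2))
  then show ?thesis by (simp add: nblocks_def nb_def blocks_eq[OF assms] card_image)
qed

section \<open>Identification, contraction and deletion on edge sets\<close>

lemma nblocks_identify:
  assumes wf: "wf_graph H" and u: "x \<in> verts H" "x \<noteq> y"
  shows "nblocks (identify H x y) = nb (glue x y (ends H)) (edges H)"
proof -
  have en: "ends (identify H x y) = glue x y (ends H)"
    by (auto simp: identify_def glue_def merge_def fun_eq_iff)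
  have "wf_graph (identify H x y)"
    unfolding wf_graph_def en
  proof (intro conjI ballI allI impI)
    show "finite (verts (identify H x y))" "finite (edges (identify H x y))"
      using wf by (auto simp: wf_graph_def identify_def)
    fix e
    { assume "e \<in> edges (identify H x y)"
      then have e: "e \<in> edges H" by (simp add: identify_def)
      note w = wf_endsD[OF wf e]
      show "glue x y (ends H) e \<subseteq> verts (identify H x y)"
        using w(1) u by (auto simp: glue_def merge_def identify_def)
      have "card (glue x y (ends H) e) \<le> 2"
        using card_image_le[OF w(3), of "merge x y"] w(4) by (simp add: glue_def)
      moreover have "card (glue x y (ends H) e) \<noteq> 0"
        using w(2,3) by (simp add: glue_def)
      ultimately show "card (glue x y (ends H) e) = 1 \<or> card (glue x y (ends H) e) = 2" by linarith }
    assume "e \<notin> edges (identify H x y)"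
    then show "glue x y (ends H) e = {}" using wf by (simp add: wf_graph_def glue_def identify_def)
  qed
  moreover have "edges (identify H x y) = edges H" by (simp add: identify_def)
  ultimately show ?thesis by (simp add: nblocks_eq_nb en)
qed

lemma wf_delete_edge: "wf_graph G \<Longrightarrow> wf_graph (delete_edge G e)"
  by (auto simp: wf_graph_def delete_edge_def)

text \<open>\<open>contract\<close> picks the surviving end by \<open>SOME\<close>;
  \<open>nb_glue_commute\<close> removes the dependence on this choice.\<close>

lemma nblocks_contract:
  assumes wf: "wf_graph G" and e: "e \<in> edges G" "ends G e = {x, y}" "x \<noteq> y"
  shows "nblocks (contract G e) = nb (glue x y (ends G)) (edges G - {e})"
proof -
  define u1 u2 where "u1 = (SOME x. x \<in> ends G e)" and "u2 = (SOME y. y \<in> ends G e - {u1})"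
  have u1: "u1 \<in> {x, y}" unfolding u1_def e(2) by (rule someI[of _ x]) simp
  then have "\<exists>t. t \<in> ends G e - {u1}" using e by auto
  then have "u2 \<in> ends G e - {u1}" unfolding u2_def by (rule someI_ex)
  then have u12: "u1 = x \<and> u2 = y \<or> u1 = y \<and> u2 = x" using u1 e by auto
  have "contract G e = identify (delete_edge G e) u1 u2"
    unfolding contract_def Let_def u1_def u2_def using e by simp
  moreover have "u1 \<in> verts (delete_edge G e)"
    using u12 wf_endsD(1)[OF wf e(1)] e(2) by (auto simp: delete_edge_def)
  ultimately have "nblocks (contract G e) = nb (glue u1 u2 (ends (delete_edge G e))) (edges G - {e})"
    using nblocks_identify[OF wf_delete_edge[OF wf], of u1 e u2] u12 e(3) by (auto simp: delete_edge_def)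
  also have "\<dots> = nb (glue u1 u2 (ends G)) (edges G - {e})"
    by (rule nb_cong) (auto simp: glue_def delete_edge_def)
  also have "\<dots> = nb (glue x y (ends G)) (edges G - {e})"
    using u12 nb_glue_commute by metis
  finally show ?thesis .
qed

lemma nonsep_delete_edge_iff:
  assumes "wf_graph G" "2 \<le> card (verts G)"
  shows "nonsep (delete_edge G e) \<longleftrightarrow>
    insep (ends G) (edges G - {e}) \<and> verts G = vs (ends G) (edges G - {e})"
proof -
  have "insep (ends (delete_edge G e)) (edges G - {e}) = insep (ends G) (edges G - {e})"
    by (rule insep_cong) (auto simp: delete_edge_def)
  moreover have "vs (ends (delete_edge G e)) (edges G - {e}) = vs (ends G) (edges G - {e})"
    by (rule vs_cong) (auto simp: delete_edge_def)
  ultimately show ?thesis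
    using nonsep_iff_insep[OF wf_delete_edge[OF assms(1)], of e] assms(2) by (simp add: delete_edge_def)
qed

section \<open>Translation of the defining conditions of \<open>Phi\<close>\<close>

lemma doubleton_eqI:
  assumes "\<And>t. \<not> I \<subseteq> {t}" "I \<subseteq> {x, y}"
  shows "I = {x, y}"
  using assms(1)[of x] assms(1)[of y] assms(2) by auto

text \<open>An edge of an inseparable set shares two vertices with the other edges, hence both its
  ends. So deleting an edge uncovers no vertex.\<close>

lemma insep_ends_subset:
  assumes "insep en E" "e \<in> E" "E \<noteq> {e}" "en e = {x, y}"
  shows "en e \<subseteq> vs en (E - {e})"
proof -
  have "\<not> vs en {e} \<inter> vs en (E - {e}) \<subseteq> {t}" for t
    by (rule insepD[OF assms(1)]) (use assms in auto)
  from this[of x] this[of y] show ?thesis using assms(4) by auto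
qed

lemma Phi_imp_Phi_edges:
  assumes wf: "wf_graph G" and G: "G \<in> Phi"
  shows "Phi_edges (ends G) (edges G) \<and> verts G = vs (ends G) (edges G)"
proof -
  have G': "nonsep G" "2 \<le> card (verts G)" "\<And>e. e \<in> edges G \<Longrightarrow> nonsep (delete_edge G e)"
    "\<And>e. e \<in> edges G \<Longrightarrow> even (nblocks (contract G e))"
    and c: "\<And>G1 G2 u1 u2. subgraph G1 G \<and> subgraph G2 G \<and>
        card (edges G1) \<ge> 2 \<and> card (edges G2) \<ge> 2 \<and> u1 \<noteq> u2 \<and>
        verts G1 \<inter> verts G2 = {u1, u2} \<and> verts G1 \<union> verts G2 = verts G \<and>
        edges G1 \<inter> edges G2 = {} \<and> edges G1 \<union> edges G2 = edges G \<Longrightarrow>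
        (even (int (nblocks (identify G1 u1 u2))) \<longleftrightarrow> even (int (nblocks G1) - 1)) \<and>
        (even (int (nblocks G1) - 1) \<longleftrightarrow> even (int (nblocks G2)))"
    using G unfolding Phi_def mem_Collect_eq by blast+
  have ins: "insep (ends G) (edges G)" and V: "verts G = vs (ends G) (edges G)"
    using nonsep_iff_insep[OF wf] G' by auto
  have two: "card (ends G e) = 2" if "e \<in> edges G" for e
    using G'(1,2) wf that by (auto simp: nonsep_def is_loop_def wf_graph_def)
  have "Phi_edges (ends G) (edges G)"
    unfolding Phi_edges_def
  proof (intro conjI ballI allI impI; (elim conjE)?)
    show "finite (edges G)" using wf by (simp add: wf_graph_def)
    show "insep (ends G) (edges G)" by (rule ins)
    show "card (ends G e) = 2" "insep (ends G) (edges G - {e})" if "e \<in> edges G" for e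
      using two G'(3)[OF that] nonsep_delete_edge_iff[OF wf G'(2)] that by auto
    show "even (nb (glue x y (ends G)) (edges G - {e}))" if "e \<in> edges G" "ends G e = {x, y}" for e x y
    proof -
      have "x \<noteq> y" using two that by fastforce
      then show ?thesis using nblocks_contract[OF wf that] G'(4)[OF that(1)] by simp
    qed
    fix A B x y
    assume AB: "A \<union> B = edges G" "A \<inter> B = {}" "2 \<le> card A" "2 \<le> card B" "x \<noteq> y"
      "vs (ends G) A \<inter> vs (ends G) B = {x, y}"
    have sub: "A \<subseteq> edges G" "B \<subseteq> edges G" unfolding AB(1)[symmetric] by auto
    note sA = subgraph_edge_subgraph[OF wf sub(1)] and sB = subgraph_edge_subgraph[OF wf sub(2)]
    note wA = wf_subgraph[OF wf sA] and wB = wf_subgraph[OF wf sB]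
    have "x \<in> verts (edge_subgraph G A)" using AB(6) by auto
    then have "nblocks (identify (edge_subgraph G A) x y) = nb (glue x y (ends (edge_subgraph G A))) A"
      using nblocks_identify[OF wA] AB(5) by simp
    also have "\<dots> = nb (glue x y (ends G)) A" by (rule nb_cong) (simp add: glue_def)
    finally have n1: "nblocks (identify (edge_subgraph G A) x y) = nb (glue x y (ends G)) A" .
    have n2: "nblocks (edge_subgraph G A) = nb (ends G) A" "nblocks (edge_subgraph G B) = nb (ends G) B"
      using nblocks_eq_nb[OF wA] nblocks_eq_nb[OF wB] nb_cong[of A "ends (edge_subgraph G A)" "ends G"]
        nb_cong[of B "ends (edge_subgraph G B)" "ends G"] by auto
    have "vs (ends G) A \<union> vs (ends G) B = verts G" unfolding V AB(1)[symmetric] by simp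
    then show "parity (ends G) A B x y"
      using c[of "edge_subgraph G A" "edge_subgraph G B" x y] sA sB AB n1 n2 by (simp add: parity_def)
  qed
  then show ?thesis using V by simp
qed

lemma Phi_edges_imp_Phi:
  assumes wf: "wf_graph G" and G: "Phi_edges (ends G) (edges G)" and V: "verts G = vs (ends G) (edges G)"
  shows "G \<in> Phi"
  unfolding Phi_def mem_Collect_eq
proof (intro conjI ballI allI impI wf; (elim conjE)?)
  note G = Phi_edgesD[OF G]
  show "nonsep G" by (rule insep_imp_nonsep[OF wf G(3) V])
  obtain e where e: "e \<in> edges G" using insep_nonempty[OF G(3)] by auto
  have "card (ends G e) \<le> card (verts G)"
    using wf wf_endsD(1)[OF wf e] by (intro card_mono) (auto simp: wf_graph_def)
  then show card: "2 \<le> card (verts G)" using G(2)[OF e] by simp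
  have ends: "\<exists>x y. ends G e = {x, y} \<and> x \<noteq> y" if "e \<in> edges G" for e
    using G(2)[OF that] by (auto simp: card_2_iff)
  show "nonsep (delete_edge G e)" if e: "e \<in> edges G" for e
  proof -
    have "edges G \<noteq> {e}" using insep_nonempty[OF G(4)[OF e]] by auto
    then have "ends G e \<subseteq> vs (ends G) (edges G - {e})"
      using insep_ends_subset[OF G(3) e] ends[OF e] by auto
    moreover have "edges G = insert e (edges G - {e})" using e by auto
    ultimately have "vs (ends G) (edges G) = vs (ends G) (edges G - {e})"
      using vs_simps(2) by (metis sup.absorb2)
    then show ?thesis using nonsep_delete_edge_iff[OF wf card] G(4)[OF e] V by simp
  qed
  show "even (nblocks (contract G e))" if e: "e \<in> edges G" for e
    using ends[OF e] nblocks_contract[OF wf e] G(5)[OF e] by auto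
  fix G1 G2 u1 u2
  assume s: "subgraph G1 G" "subgraph G2 G" "2 \<le> card (edges G1)" "2 \<le> card (edges G2)" "u1 \<noteq> u2"
    "verts G1 \<inter> verts G2 = {u1, u2}" "edges G1 \<inter> edges G2 = {}" "edges G1 \<union> edges G2 = edges G"
  note w1 = wf_subgraph[OF wf s(1)] and w2 = wf_subgraph[OF wf s(2)]
  have v: "vs (ends G) (edges G1) \<subseteq> verts G1" "vs (ends G) (edges G2) \<subseteq> verts G2"
    using s(1,2) by (auto simp: subgraph_def vs_def)
  \<comment> \<open>A priori \<open>u1\<close> or \<open>u2\<close> could be isolated in
    \<open>G1\<close> or \<open>G2\<close>; inseparability of \<open>G\<close> guarantees that the
    edge sets meet in both.\<close>
  have "\<not> vs (ends G) (edges G1) \<inter> vs (ends G) (edges G2) \<subseteq> {t}" for t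
    by (rule insepD[OF G(3)]) (use s in auto)
  moreover have "vs (ends G) (edges G1) \<inter> vs (ends G) (edges G2) \<subseteq> {u1, u2}"
    unfolding s(6)[symmetric] using v by auto
  ultimately have "vs (ends G) (edges G1) \<inter> vs (ends G) (edges G2) = {u1, u2}"
    by (intro doubleton_eqI)
  then have p: "parity (ends G) (edges G1) (edges G2) u1 u2" using G(6) s by blast
  have "u1 \<in> verts G1" using s(6) by auto
  then have "nblocks (identify G1 u1 u2) = nb (glue u1 u2 (ends G1)) (edges G1)"
    using nblocks_identify[OF w1] s(5) by simp
  also have "\<dots> = nb (glue u1 u2 (ends G)) (edges G1)"
    using subgraph_ends[OF s(1)] by (intro nb_cong) (simp add: glue_def)
  finally have n1: "nblocks (identify G1 u1 u2) = nb (glue u1 u2 (ends G)) (edges G1)" .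
  have n2: "nblocks G1 = nb (ends G) (edges G1)" "nblocks G2 = nb (ends G) (edges G2)"
    using nblocks_eq_nb[OF w1] nblocks_eq_nb[OF w2] nb_cong[OF subgraph_ends[OF s(1)]]
      nb_cong[OF subgraph_ends[OF s(2)]] by auto
  show "even (int (nblocks (identify G1 u1 u2))) = even (int (nblocks G1) - 1)"
    "even (int (nblocks G1) - 1) = even (int (nblocks G2))"
    using p n1 n2 by (simp_all add: parity_def)
qed

section \<open>Isomorphism and the main theorem\<close>

text \<open>Pulls the conditions back along an isomorphism, from a representative in
  \<open>Theta\<close> to an arbitrary graph.\<close>

lemma Phi_edges_iso:
  assumes psi: "inj_on \<psi> E" and phi: "inj_on \<phi> (vs en E)" and en2: "\<And>e. e \<in> E \<Longrightarrow> en2 (\<psi> e) = \<phi> ` en e"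
    and G: "Phi_edges en2 (\<psi> ` E)"
  shows "Phi_edges en E"
proof -
  note G = Phi_edgesD[OF G]
  have v: "vs en2 (\<psi> ` A) = \<phi> ` vs en A" if "A \<subseteq> E" for A
    using that en2 by (intro vs_iso) auto
  have sub: "vs en A \<subseteq> vs en E" if "A \<subseteq> E" for A using that by (rule vs_mono)
  have i: "insep en2 (\<psi> ` A) \<longleftrightarrow> insep en A" "nb en2 (\<psi> ` A) = nb en A" if "A \<subseteq> E" for A
    using that insep_iso[OF inj_on_subset[OF psi that] inj_on_subset[OF phi sub[OF that]] en2]
      nb_iso[OF inj_on_subset[OF psi that] inj_on_subset[OF phi sub[OF that]] en2] by auto
  have m: "merge (\<phi> x) (\<phi> y) (\<phi> t) = \<phi> (merge x y t)" if "y \<in> vs en E" "t \<in> vs en E" for x y t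
    using inj_onD[OF phi _ that(2,1)] by (auto simp: merge_def)
  have g: "nb (glue (\<phi> x) (\<phi> y) en2) (\<psi> ` A) = nb (glue x y en) A"
    if A: "A \<subseteq> E" and xy: "x \<in> vs en E" "y \<in> vs en E" for A x y
  proof (rule nb_iso)
    show "inj_on \<psi> A" using inj_on_subset[OF psi A] .
    have "vs (glue x y en) A \<subseteq> vs en E" using sub[OF A] xy by (auto simp: vs_glue merge_def)
    then show "inj_on \<phi> (vs (glue x y en) A)" using inj_on_subset[OF phi] by blast
    fix e assume "e \<in> A"
    then have e: "e \<in> E" using A by auto
    then have "en e \<subseteq> vs en E" by (rule ends_subset_vs)
    then show "glue (\<phi> x) (\<phi> y) en2 (\<psi> e) = \<phi> ` glue x y en e"
      unfolding glue_def en2[OF e] image_image using m[OF xy(2)] by (intro image_cong) auto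
  qed
  have minus: "\<psi> ` E - {\<psi> e} = \<psi> ` (E - {e})" if "e \<in> E" for e
    using psi that by (auto simp: inj_on_def)
  show ?thesis
    unfolding Phi_edges_def
  proof (intro conjI ballI allI impI; (elim conjE)?)
    show "finite E" using G(1) psi by (rule finite_imageD)
    show "insep en E" using i(1)[of E] G(3) by simp
    show "card (en e) = 2" if e: "e \<in> E" for e
      using G(2)[of "\<psi> e"] en2[OF e] card_image[OF inj_on_subset[OF phi ends_subset_vs[OF e]]] e by simp
    show "insep en (E - {e})" if e: "e \<in> E" for e
      using G(4)[of "\<psi> e"] e i(1)[of "E - {e}"] minus[OF e] by auto
    show "even (nb (glue x y en) (E - {e}))" if e: "e \<in> E" "en e = {x, y}" for e x y
    proof -
      have "x \<in> vs en E" "y \<in> vs en E" using ends_subset_vs[OF e(1), of en] e(2) by auto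
      then show ?thesis
        using G(5)[of "\<psi> e" "\<phi> x" "\<phi> y"] e en2[OF e(1)] minus[OF e(1)] g[of "E - {e}" x y] by auto
    qed
    fix A B x y
    assume AB: "A \<union> B = E" "A \<inter> B = {}" "2 \<le> card A" "2 \<le> card B" "x \<noteq> y" "vs en A \<inter> vs en B = {x, y}"
    have s: "A \<subseteq> E" "B \<subseteq> E" using AB(1) by auto
    have xyA: "x \<in> vs en A" "y \<in> vs en A" using AB(6) by auto
    then have xy: "x \<in> vs en E" "y \<in> vs en E" using sub[OF s(1)] by auto
    have "parity en2 (\<psi> ` A) (\<psi> ` B) (\<phi> x) (\<phi> y)"
    proof (rule G(6))
      show "\<psi> ` A \<union> \<psi> ` B = \<psi> ` E" using AB(1) by auto
      show "\<psi> ` A \<inter> \<psi> ` B = {}" using inj_on_image_Int[OF psi s] AB(2) by simp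
      show "2 \<le> card (\<psi> ` A)" "2 \<le> card (\<psi> ` B)"
        using AB card_image[OF inj_on_subset[OF psi s(1)]] card_image[OF inj_on_subset[OF psi s(2)]] by auto
      show "\<phi> x \<noteq> \<phi> y" using AB(5) inj_onD[OF phi _ xy] by auto
      show "vs en2 (\<psi> ` A) \<inter> vs en2 (\<psi> ` B) = {\<phi> x, \<phi> y}"
        unfolding v[OF s(1)] v[OF s(2)]
        using inj_on_image_Int[OF phi sub[OF s(1)] sub[OF s(2)]] AB(6) by simp
    qed
    then show "parity en A B x y"
      using i(2)[OF s(1)] i(2)[OF s(2)] g[OF s(1) xy] by (simp add: parity_def)
  qed
qed

section \<open>The smallest case and the induction through \<open>Theta\<close>\<close>

lemma insep_pair:
  assumes "insep en {f, g}" "f \<noteq> g" "card (en f) = 2" "card (en g) = 2"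
  shows "en f = en g"
proof -
  obtain x y where f: "en f = {x, y}" "x \<noteq> y" using assms(3) by (auto simp: card_2_iff)
  obtain p q where g: "en g = {p, q}" using assms(4) by (auto simp: card_2_iff)
  have "\<not> vs en {f} \<inter> vs en {g} \<subseteq> {t}" for t
    by (rule insepD[OF assms(1)]) (use assms in auto)
  from this[of x] this[of y] show ?thesis using f g by auto
qed

text \<open>Contracting one of three parallel edges leaves two loops, hence two blocks; three edges
  cannot be divided into two sides with two edges each.\<close>

lemma Phi_edges_triple:
  assumes "card E = 3" "e \<in> E" "x \<noteq> y" and en: "\<And>e. e \<in> E \<Longrightarrow> en e = {x, y}"
  shows "Phi_edges en E"
proof -
  have fin: "finite E" using assms(1) by (metis card.infinite zero_neq_numeral)
  have par: "insep en S" if "S \<subseteq> E" "S \<noteq> {}" for S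
    using that en assms(3) by (intro insep_multi_edge[of _ x y]) auto
  have minus: "card (E - {e}) = 2" if "e \<in> E" for e using assms(1) fin that by simp
  have ne: "E - {e} \<noteq> {}" if "e \<in> E" for e
    using minus[OF that] by (metis card.empty zero_neq_numeral)
  show ?thesis
    unfolding Phi_edges_def
  proof (intro conjI ballI allI impI fin; (elim conjE)?)
    show "card (en e) = 2" if "e \<in> E" for e using en[OF that] assms(3) by simp
    show "insep en (E - {e})" if "e \<in> E" for e
      using par[of "E - {e}"] ne[OF that] by auto
    show "insep en E" using par[of E] assms(2) by auto
    show "even (nb (glue p q en) (E - {e}))" if e: "e \<in> E" "en e = {p, q}" for e p q
    proof -
      obtain f g where fg: "E - {e} = {f, g}" "f \<noteq> g" using minus[OF e(1)] by (auto simp: card_2_iff)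
      have "f \<in> E" "g \<in> E" using fg(1) by auto
      then have "en f = {p, q}" "en g = {p, q}" using en e by auto
      then have l: "glue p q en f = {p}" "glue p q en g = {p}" by (auto simp: glue_def merge_def)
      have "nb (glue p q en) ({f} \<union> {g}) = nb (glue p q en) {f} + nb (glue p q en) {g}"
        using l fg(2) by (intro nb_Un[of _ _ _ p]) auto
      moreover have "{f} \<union> {g} = E - {e}" using fg by auto
      ultimately show ?thesis by (simp add: nb_insep insep_singleton)
    qed
    fix A B p q
    assume AB: "A \<union> B = E" "A \<inter> B = {}" "2 \<le> card A" "2 \<le> card B"
    have "finite A" "finite B" using fin AB(1) by auto
    then have "card A + card B = 3" using AB(1,2) assms(1) by (metis card_Un_disjoint)
    then show "parity en A B p q" using AB(3,4) by simp
  qed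
qed

lemma (in edge_expansion) twoconn_expansionI:
  assumes G: "Phi_edges en' (insert e' D)" and D: "fresh D"
  shows "twoconn_expansion en en' e' f1 f2 f3 f4 u v w D"
proof -
  note G' = Phi_edgesD[OF G]
  have e': "e' \<notin> D" and fin: "finite D" using D by (auto simp: fresh_def)
  then have eq: "insert e' D - {e'} = D" by auto
  have uv: "u \<noteq> v" using G'(2)[of e'] en' by auto
  have ins': "insep en' D" using G'(4)[of e'] eq by simp
  \<comment> \<open>Contracting \<open>e'\<close> would leave a single edge and thus one block,
    against (b').\<close>
  have "card D \<noteq> 1"
  proof
    assume "card D = 1"
    then obtain d where "D = {d}" by (auto simp: card_1_singleton_iff)
    then show False using G'(5)[of e' u v] en' eq by (simp add: nb_insep insep_singleton)
  qed
  moreover have "card D \<noteq> 0" using insep_nonempty[OF ins'] fin by simp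
  ultimately have "2 \<le> card D" by linarith
  moreover have "insert e' D \<noteq> {e'}" using insep_nonempty[OF ins'] e' by auto
  then have "{u, v} \<subseteq> vs en D"
    using insep_ends_subset[OF G'(3) _ _ en'] eq fresh_vs[OF D] en' by simp
  moreover have "card (en e) = 2" if "e \<in> D" for e
    using G'(2)[of e] D that by (auto simp: fresh_def)
  ultimately show ?thesis
    using D ins' fresh_insep[OF D] uv by unfold_locales auto
qed

lemma expand_Phi_edges:
  assumes G: "Phi_edges (ends G) (edges G)" "verts G = vs (ends G) (edges G)"
    and e: "e \<in> edges G" "ends G e = {u1, u2}" and new: "w \<notin> verts G"
    and f: "distinct [f1, f2, f3, f4]" "{f1, f2, f3, f4} \<inter> edges G = {}"
  defines "H \<equiv> expand G e u1 u2 w f1 f2 f3 f4"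
  shows "Phi_edges (ends H) (edges H)" "verts H = vs (ends H) (edges H)"
proof -
  define D where "D = edges G - {e}"
  have ED: "edges G = insert e D" "e \<notin> D" using e by (auto simp: D_def)
  have H: "verts H = insert w (verts G)" "edges H = D \<union> {f1, f2, f3, f4}"
    "ends H = ((ends G)(e := {}))(f1 := {w, u1}, f2 := {w, u1}, f3 := {w, u2}, f4 := {w, u2})"
    by (simp_all add: H_def expand_def D_def)
  have "{u1, u2} \<subseteq> verts G" using G(2) e ends_subset_vs[OF e(1), of "ends G"] by simp
  then interpret edge_expansion "ends H" "ends G" e f1 f2 f3 f4 u1 u2 w
    using f e new by unfold_locales (auto simp: H)
  have agree: "ends G d = ends H d" if "d \<in> D" for d
    using that ED f(2) unfolding H(3) by auto
  have "vs (ends H) D = vs (ends G) D" using agree by (intro vs_cong) simp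
  then have "w \<notin> vs (ends H) D" using new unfolding G(2) ED(1) by simp
  then have D: "fresh D"
    using agree ED f(2) Phi_edgesD(1)[OF G(1)] by (auto simp: fresh_def)
  have V: "verts G = {u1, u2} \<union> vs (ends H) D" using G(2) ED(1) e(2) fresh_vs[OF D] by simp
  interpret twoconn_expansion "ends H" "ends G" e f1 f2 f3 f4 u1 u2 w D
    using twoconn_expansionI[OF _ D] G(1) ED by simp
  show "Phi_edges (ends H) (edges H)" using Phi_edges_expand G(1) ED(1) H(2) by simp
  have "vs (ends H) (edges H) = vs (ends H) D \<union> {w, u1, u2}" using H(2) vs_F by (metis vs_simps(3))
  then show "verts H = vs (ends H) (edges H)" using H(1) V by auto
qed

lemma Theta_Phi_edges:
  assumes "H \<in> Theta"
  shows "Phi_edges (ends H) (edges H) \<and> verts H = vs (ends H) (edges H)"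
  using assms
proof (induction rule: Theta.induct)
  case Z3
  have "Phi_edges (ends Z3) (edges Z3)"
    by (rule Phi_edges_triple[of _ 0 0 1]) (auto simp: Z3_def)
  then show ?case by (auto simp: Z3_def vs_def)
next
  case (expand G e u1 u2 w f1 f2 f3 f4)
  from expand_Phi_edges[OF _ _ expand.hyps(2-6)] expand.IH show ?case by simp
qed

text \<open>A single edge is excluded by (a'), two edges by (b'), since contraction would leave one
  block. Of three edges, deleting one leaves an inseparable pair, hence two parallel edges.\<close>

lemma Phi_edges_small:
  assumes G: "Phi_edges en E" and c: "card E < 4"
  obtains x y where "card E = 3" "x \<noteq> y" "\<And>e. e \<in> E \<Longrightarrow> en e = {x, y}"
proof -
  note G' = Phi_edgesD[OF G]
  obtain e where e: "e \<in> E" using insep_nonempty[OF G'(3)] by auto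
  obtain x y where xy: "en e = {x, y}" "x \<noteq> y" using G'(2)[OF e] by (auto simp: card_2_iff)
  have "E - {e} \<noteq> {}" using insep_nonempty[OF G'(4)[OF e]] .
  then have "card (E - {e}) \<noteq> 0" using G'(1) by simp
  moreover have "card (E - {e}) \<noteq> 1"
  proof
    assume "card (E - {e}) = 1"
    then obtain d where "E - {e} = {d}" by (rule card_1_singletonE)
    then show False using G'(5)[OF e xy(1)] by (simp add: nb_insep insep_singleton)
  qed
  moreover have "card E = Suc (card (E - {e}))" using e G'(1) by (metis card_Suc_Diff1)
  ultimately have two: "card (E - {e}) = 2" and three: "card E = 3" using c by linarith+
  obtain f g where fg: "E - {e} = {f, g}" "f \<noteq> g" using two by (auto simp: card_2_iff)
  have "E = insert e (E - {e})" using e by auto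
  then have E: "E = {e, f, g}" unfolding fg(1) .
  have "e \<notin> E - {e}" by simp
  then have ne: "e \<noteq> f" "e \<noteq> g" unfolding fg(1) by auto
  have i: "insep en {e, g}" "insep en {e, f}"
    using G'(4)[of f] G'(4)[of g] ne fg(2) unfolding E by (auto simp: insert_Diff_if)
  have c2: "card (en e) = 2" "card (en f) = 2" "card (en g) = 2" using G'(2) unfolding E by auto
  have eq: "en g = {x, y}" "en f = {x, y}"
    using insep_pair[OF i(1) ne(2) c2(1,3)] insep_pair[OF i(2) ne(1) c2(1,2)] xy(1) by auto
  show thesis
  proof (rule that[OF three xy(2)])
    fix d assume "d \<in> E"
    then show "en d = {x, y}" unfolding E using eq xy(1) by blast
  qed
qed

lemma finite_fresh4:
  assumes "finite (S :: nat set)"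
  obtains f1 f2 f3 f4 where "distinct [f1, f2, f3, f4]" "{f1, f2, f3, f4} \<inter> S = {}"
proof -
  obtain n where n: "\<And>s. s \<in> S \<Longrightarrow> s < n" using assms finite_nat_set_iff_bounded by auto
  have "\<not> (\<exists>s\<in>S. n \<le> s)" using n by (auto simp: not_le)
  then have "{n, n + 1, n + 2, n + 3} \<inter> S = {}" by auto
  then show thesis using that[of n "n + 1" "n + 2" "n + 3"] by simp
qed

lemma Phi_edges_imp_Theta:
  fixes en :: "'e \<Rightarrow> 'v set"
  assumes "Phi_edges en E"
  shows "\<exists>H\<in>Theta. \<exists>\<phi> \<psi>. bij_betw \<phi> (vs en E) (verts H) \<and> bij_betw \<psi> E (edges H) \<and>
    (\<forall>e\<in>E. ends H (\<psi> e) = \<phi> ` en e)"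
  using assms
proof (induction "card E" arbitrary: en E rule: less_induct)
  case less
  show ?case
  proof (cases "card E < 4")
    case True
    obtain x y where xy: "card E = 3" "x \<noteq> y" and en: "\<And>e. e \<in> E \<Longrightarrow> en e = {x, y}"
      using Phi_edges_small[OF less.prems True] by blast
    obtain e f g where E: "E = {e, f, g}" "e \<noteq> f" "e \<noteq> g" "f \<noteq> g"
      using xy(1) by (auto simp: card_3_iff)
    define \<phi> :: "'v \<Rightarrow> nat" where "\<phi> = (\<lambda>t. if t = x then 0 else 1)"
    define \<psi> :: "'e \<Rightarrow> nat" where "\<psi> = (\<lambda>t. if t = e then 0 else if t = f then 1 else 2)"
    have V: "vs en E = {x, y}" using en E by auto
    have "bij_betw \<phi> (vs en E) (verts Z3)"
      unfolding V using xy(2) by (auto simp: bij_betw_def \<phi>_def Z3_def)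
    moreover have "bij_betw \<psi> E (edges Z3)"
      unfolding E(1) using E(2-4) by (auto simp: bij_betw_def \<psi>_def Z3_def)
    moreover have "\<forall>t\<in>E. ends Z3 (\<psi> t) = \<phi> ` en t"
      using en xy(2) by (auto simp: \<psi>_def \<phi>_def Z3_def)
    ultimately show ?thesis using Theta.Z3 by blast
  next
    case False
    then obtain R a1 a2 b1 b2 x y c where
      E: "E = R \<union> {a1, a2, b1, b2}" "distinct [a1, a2, b1, b2]" "R \<inter> {a1, a2, b1, b2} = {}" and
      en: "en a1 = {c, x}" "en a2 = {c, x}" "en b1 = {c, y}" "en b2 = {c, y}" and
      R: "c \<notin> vs en R" "x \<noteq> y" "{x, y} \<subseteq> vs en R" "insep en R" "2 \<le> card R"
      using Phi_edges_structure[OF less.prems] by (metis not_less)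
    define en' where "en' = en(a1 := {x, y})"
    interpret edge_expansion en en' a1 a1 a2 b1 b2 x y c
      using E en R by unfold_locales (auto simp: en'_def)
    have finE: "finite E" using Phi_edgesD(1)[OF less.prems] .
    then have fin: "finite R" using E(1) by auto
    have fresh: "fresh R" using E(3) R(1) fin unfolding fresh_def by (auto simp: en'_def)
    interpret twoconn_expansion en en' a1 a1 a2 b1 b2 x y c R
      using fresh R E Phi_edgesD(2)[OF less.prems] by unfold_locales auto
    have red: "Phi_edges en' (insert a1 R)" using Phi_edges_reduce less.prems E(1) by simp
    have "insert a1 R \<subset> E" using E by auto
    then have "card (insert a1 R) < card E" using finE by (rule psubset_card_mono[rotated])
    then obtain H \<phi> \<psi> where H: "H \<in> Theta" and bij: "bij_betw \<phi> (vs en' (insert a1 R)) (verts H)"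
      "bij_betw \<psi> (insert a1 R) (edges H)" and iso: "\<forall>e\<in>insert a1 R. ends H (\<psi> e) = \<phi> ` en' e"
      using less.hyps red by blast
    have V': "vs en' (insert a1 R) = vs en R" using fresh_vs[OF fresh] R(3) by (auto simp: en'_def)
    have V: "vs en E = insert c (vs en R)" using E(1) en R(3) by auto
    have "finite (edges H)" using Theta_Phi_edges[OF H] Phi_edgesD(1) by blast
    then obtain f1 f2 f3 f4 where f: "distinct [f1, f2, f3, f4]" "{f1, f2, f3, f4} \<inter> edges H = {}"
      using finite_fresh4 by blast
    have "finite (en e)" if "e \<in> R" for e
      using Phi_edgesD(2)[OF less.prems, of e] E(1) that by (intro card_ge_0_finite) simp
    then have "finite (vs en R)" unfolding vs_def using fin by (rule finite_UN_I[rotated])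
    then have "finite (verts H)" using bij(1) bij_betw_finite V' by metis
    then obtain w where w: "w \<notin> verts H" using infinite_UNIV_nat ex_new_if_finite by metis
    define H' where "H' = expand H (\<psi> a1) (\<phi> x) (\<phi> y) w f1 f2 f3 f4"
    have a1: "\<psi> a1 \<in> edges H" "ends H (\<psi> a1) = {\<phi> x, \<phi> y}"
      using bij_betwE[OF bij(2)] iso by (auto simp: en'_def)
    have H': "H' \<in> Theta" unfolding H'_def by (rule Theta.expand[OF H a1 w f])
    define \<phi>' where "\<phi>' = \<phi>(c := w)"
    \<comment> \<open>The value at \<open>a1\<close> is overwritten: the edge
      \<open>\<psi> a1\<close> of \<open>H\<close> is the one that the expansion removes.\<close>
    define \<psi>' where "\<psi>' = \<psi>(a1 := f1, a2 := f2, b1 := f3, b2 := f4)"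
    have "bij_betw \<phi>' (vs en R) (verts H)"
      using bij(1) R(1) unfolding V' by (subst bij_betw_cong[of _ _ \<phi>]) (auto simp: \<phi>'_def)
    then have "bij_betw \<phi>' (vs en R \<union> {c}) (verts H \<union> {\<phi>' c})"
      using R(1) w by (intro notIn_Un_bij_betw) (simp_all add: \<phi>'_def)
    then have b1': "bij_betw \<phi>' (vs en E) (verts H')"
      by (simp add: V H'_def expand_def \<phi>'_def)
    have a1R: "a1 \<notin> R" "a2 \<notin> R" "b1 \<notin> R" "b2 \<notin> R" using E(3) by auto
    have "\<psi> a1 \<notin> \<psi> ` R" "edges H = insert (\<psi> a1) (\<psi> ` R)" "inj_on \<psi> R"
      using bij(2) a1R(1) by (simp_all add: bij_betw_def)
    then have psiR: "bij_betw \<psi> R (edges H - {\<psi> a1})"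
      by (simp add: bij_betw_def)
    have "bij_betw \<psi>' R (edges H - {\<psi> a1})"
      using psiR a1R by (subst bij_betw_cong[of _ _ \<psi>]) (auto simp: \<psi>'_def)
    moreover have "bij_betw \<psi>' {a1, a2, b1, b2} {f1, f2, f3, f4}"
      using E(2) f(1) by (auto simp: bij_betw_def \<psi>'_def)
    ultimately have "bij_betw \<psi>' (R \<union> {a1, a2, b1, b2}) (edges H - {\<psi> a1} \<union> {f1, f2, f3, f4})"
      by (rule bij_betw_combine) (use f(2) in auto)
    then have b2': "bij_betw \<psi>' E (edges H')" by (simp add: E(1) H'_def expand_def)
    have "ends H' (\<psi>' e) = \<phi>' ` en e" if "e \<in> E" for e
    proof (cases "e \<in> R")
      case True
      then have e: "e \<noteq> a1" "e \<noteq> a2" "e \<noteq> b1" "e \<noteq> b2" using a1R by auto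
      have "\<psi> e \<in> edges H - {\<psi> a1}" using bij_betwE[OF psiR] True by auto
      then have "ends H' (\<psi>' e) = ends H (\<psi> e)"
        using e f(2) by (auto simp: \<psi>'_def H'_def expand_def)
      also have "\<dots> = \<phi> ` en e" using iso True e by (simp add: en'_def)
      also have "\<dots> = \<phi>' ` en e"
        using ends_subset_vs[OF True, of en] R(1) by (intro image_cong) (auto simp: \<phi>'_def)
      finally show ?thesis .
    next
      case False
      have "x \<noteq> c" "y \<noteq> c" using R by auto
      then show ?thesis using False that E(1,2) f(1) en by (auto simp: \<psi>'_def \<phi>'_def H'_def expand_def)
    qed
    then show ?thesis using H' b1' b2' by blast
  qed
qed

theorem theorem4p6:
  fixes G :: "('v, 'e) graph"
  assumes "wf_graph G"
  shows "G \<in> Phi \<longleftrightarrow> (\<exists>H\<in>Theta. graph_iso G H)"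
proof
  assume "G \<in> Phi"
  then have "Phi_edges (ends G) (edges G)" "verts G = vs (ends G) (edges G)"
    using Phi_imp_Phi_edges[OF assms] by auto
  then show "\<exists>H\<in>Theta. graph_iso G H"
    using Phi_edges_imp_Theta unfolding graph_iso_def by fastforce
next
  assume "\<exists>H\<in>Theta. graph_iso G H"
  then obtain H \<phi> \<psi> where H: "H \<in> Theta" and phi: "bij_betw \<phi> (verts G) (verts H)"
    and psi: "bij_betw \<psi> (edges G) (edges H)" and iso: "\<And>e. e \<in> edges G \<Longrightarrow> ends H (\<psi> e) = \<phi> ` ends G e"
    by (auto simp: graph_iso_def)
  have PH: "Phi_edges (ends H) (edges H)" "verts H = vs (ends H) (edges H)"
    using Theta_Phi_edges[OF H] by auto
  have E: "edges H = \<psi> ` edges G" using psi by (simp add: bij_betw_def)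
  have sub: "vs (ends G) (edges G) \<subseteq> verts G" by (rule wf_vs[OF assms]) simp
  have inj: "inj_on \<phi> (verts G)" using phi by (simp add: bij_betw_def)
  have "Phi_edges (ends G) (edges G)"
  proof (rule Phi_edges_iso)
    show "inj_on \<psi> (edges G)" using psi by (simp add: bij_betw_def)
    show "inj_on \<phi> (vs (ends G) (edges G))" using inj_on_subset[OF inj sub] .
  qed (use iso PH E in auto)
  \<comment> \<open>\<open>H\<close> is covered by its edges, so injectivity of
    \<open>\<phi>\<close> rules out isolated vertices of \<open>G\<close>.\<close>
  moreover have "\<phi> ` vs (ends G) (edges G) = \<phi> ` verts G"
    using vs_iso[of "edges G" "ends H" \<psi> \<phi> "ends G"] iso PH(2) E phi by (simp add: bij_betw_def)
  then have "vs (ends G) (edges G) = verts G" using inj_on_image_eq_iff[OF inj sub] by simp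
  ultimately show "G \<in> Phi" using Phi_edges_imp_Phi[OF assms] by simp
qed

end
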